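(* There is an algorithm that, given an $n$-vertex graph $G$ with maximum degree $\Delta$ and an integer $k$, decides in time $O^*\bigl((2^{\Delta+1}-2)^{n/(\Delta+1)}\bigr)$ whether $G$ admits a packing with $k$ dominating sets, i.e. whether there exist $k$ pairwise disjoint dominating sets of $G$.
   Context: A set $D$ of vertices of a graph is dominating if every vertex not in $D$ has at least one neighbour in $D$. The notation $O^*(\cdot)$ suppresses factors polynomial in $n$.
   Formalization: For maximum degree 0 (a graph with vertices but no edges) the stated bound equals 0, which no algorithm can meet; the bound is replaced by the maximum of 1 and the stated expression, which changes nothing when Δ ≥ 1. *)

theory Defs
  imports Complex_Main "HOL-Library.Log_Nat" "HOL-Library.Disjoint_Sets"
    "HOL-Computational_Algebra.Polynomial"
begin

section \<open>Graphs and packings of dominating sets\<close>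

definition simple_graph :: "'a set \<Rightarrow> 'a set set \<Rightarrow> bool" where
  "simple_graph V E \<longleftrightarrow> finite V \<and> (\<forall>e\<in>E. e \<subseteq> V \<and> card e = 2)"

definition neighbours :: "'a set set \<Rightarrow> 'a \<Rightarrow> 'a set" where
  "neighbours E v = {u. {u, v} \<in> E}"

text \<open>The inserted \<open>0\<close> only matters for the graph without vertices.\<close>

definition max_degree :: "'a set \<Rightarrow> 'a set set \<Rightarrow> nat" where
  "max_degree V E = Max (insert 0 ((\<lambda>v. card (neighbours E v)) ` V))"

definition dominating_set :: "'a set \<Rightarrow> 'a set set \<Rightarrow> 'a set \<Rightarrow> bool" where
  "dominating_set V E D \<longleftrightarrow> D \<subseteq> V \<and> (\<forall>v\<in>V - D. neighbours E v \<inter> D \<noteq> {})"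

definition has_dominating_packing :: "'a set \<Rightarrow> 'a set set \<Rightarrow> nat \<Rightarrow> bool" where
  "has_dominating_packing V E k \<longleftrightarrow>
     (\<exists>P. (\<forall>D\<in>P. dominating_set V E D) \<and> finite P \<and> card P = k \<and> disjoint P)"


section \<open>Random access machines with logarithmic cost\<close>

text \<open>
  Programs are those of a random access machine, presented as a while language. The memory
  consists of banks of cells holding natural numbers of arbitrary size; the bank is fixed in the
  program text (so a program uses finitely many of them), the address within a bank is computed.

  Every operation is charged by the binary length of its operands (the logarithmic cost
  criterion); multiplication and division are charged the product of these lengths, which is what
  the schoolbook algorithms take. Thus no parallelism can be hidden in long numbers, and costs
  agree with those on a random access machine with bounded word size up to factors polynomial in
  the word size.
\<close>

type_synonym memory = "nat \<Rightarrow> nat \<Rightarrow> nat"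

datatype expr =
    Num nat
  | Load nat expr
  | Add expr expr
  | Sub expr expr
  | Mul expr expr
  | Div expr expr

datatype prog =
    Skip
  | Store nat expr expr
  | Seq prog prog
  | If expr prog prog
  | While expr prog

definition len :: "nat \<Rightarrow> nat" where
  "len x = max 1 (floorlog 2 x)"

fun eval_expr :: "expr \<Rightarrow> memory \<Rightarrow> nat" where
  "eval_expr (Num c) m = c"
| "eval_expr (Load b e) m = m b (eval_expr e m)"
| "eval_expr (Add e f) m = eval_expr e m + eval_expr f m"
| "eval_expr (Sub e f) m = eval_expr e m - eval_expr f m"
| "eval_expr (Mul e f) m = eval_expr e m * eval_expr f m"
| "eval_expr (Div e f) m = eval_expr e m div eval_expr f m"

fun cost_expr :: "expr \<Rightarrow> memory \<Rightarrow> nat" where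
  "cost_expr (Num c) m = len c"
| "cost_expr (Load b e) m =
     cost_expr e m + len (eval_expr e m) + len (m b (eval_expr e m))"
| "cost_expr (Add e f) m =
     cost_expr e m + cost_expr f m + len (eval_expr e m) + len (eval_expr f m)"
| "cost_expr (Sub e f) m =
     cost_expr e m + cost_expr f m + len (eval_expr e m) + len (eval_expr f m)"
| "cost_expr (Mul e f) m =
     cost_expr e m + cost_expr f m + len (eval_expr e m) * len (eval_expr f m)"
| "cost_expr (Div e f) m =
     cost_expr e m + cost_expr f m + len (eval_expr e m) * len (eval_expr f m)"

text \<open>
  \<open>exec p m t m'\<close>: started in memory \<open>m\<close>, program \<open>p\<close> terminates at total cost \<open>t\<close> with
  memory \<open>m'\<close>. A condition holds iff its value is nonzero; \<open>Store b e f\<close> writes the value of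
  \<open>f\<close> to the address given by \<open>e\<close> in bank \<open>b\<close>.
\<close>

inductive exec :: "prog \<Rightarrow> memory \<Rightarrow> nat \<Rightarrow> memory \<Rightarrow> bool" where
  Skip: "exec Skip m 1 m"
| Store: "exec (Store b e f) m
     (cost_expr e m + cost_expr f m + len (eval_expr e m) + len (eval_expr f m))
     (m(b := (m b)(eval_expr e m := eval_expr f m)))"
| Seq: "exec p m t m' \<Longrightarrow> exec q m' t' m'' \<Longrightarrow> exec (Seq p q) m (t + t') m''"
| IfTrue: "eval_expr e m \<noteq> 0 \<Longrightarrow> exec p m t m' \<Longrightarrow>
     exec (If e p q) m (cost_expr e m + t + 1) m'"
| IfFalse: "eval_expr e m = 0 \<Longrightarrow> exec q m t m' \<Longrightarrow>
     exec (If e p q) m (cost_expr e m + t + 1) m'"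
| WhileTrue: "eval_expr e m \<noteq> 0 \<Longrightarrow> exec p m t m' \<Longrightarrow> exec (While e p) m' t' m'' \<Longrightarrow>
     exec (While e p) m (cost_expr e m + t + t' + 1) m''"
| WhileFalse: "eval_expr e m = 0 \<Longrightarrow> exec (While e p) m (cost_expr e m + 1) m"

lemma exec_deterministic:
  "exec p m t m1 \<Longrightarrow> exec p m u m2 \<Longrightarrow> t = u \<and> m1 = m2"
proof (induction arbitrary: u m2 rule: exec.induct)
  case (Skip m)
  then show ?case by cases simp
next
  case (Store b e f m)
  then show ?case by cases simp
next
  case (Seq p m t m' q t' m'')
  from Seq.prems obtain s n s' where "exec p m s n" "exec q n s' m2" "u = s + s'"
    by cases blast
  then show ?case using Seq.IH by blast
next
  case (IfTrue e m p t m' q)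
  from IfTrue.prems obtain s where "exec p m s m2" "u = cost_expr e m + s + 1"
    by cases (use IfTrue.hyps(1) in simp_all)
  then show ?case using IfTrue.IH by blast
next
  case (IfFalse e m q t m' p)
  from IfFalse.prems obtain s where "exec q m s m2" "u = cost_expr e m + s + 1"
    by cases (use IfFalse.hyps(1) in simp_all)
  then show ?case using IfFalse.IH by blast
next
  case (WhileTrue e m p t m' t' m'')
  from WhileTrue.prems obtain s n s' where
    "exec p m s n" "exec (While e p) n s' m2" "u = cost_expr e m + s + s' + 1"
    by cases (use WhileTrue.hyps(1) in simp_all)
  then show ?case using WhileTrue.IH by blast
next
  case (WhileFalse e m p)
  from WhileFalse.prems show ?case
    by cases (use WhileFalse.hyps in simp_all)
qed


section \<open>Input\<close>

text \<open>
  An instance consists of a graph with vertex set \<open>{..<n}\<close> and edge set \<open>E\<close>, and a number \<open>k\<close>.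
  Cell 0 of bank 0 holds \<open>n\<close>, bank 1 the adjacency matrix row by row, and bank 2 the binary digits
  of \<open>k\<close>, least significant first. The digits are stored as 1 and 2, so that the first 0 in bank 2
  marks the end; storing \<open>k\<close> digit by digit means that an oversized \<open>k\<close> can be recognised without
  paying for its full length.
\<close>

definition input_memory :: "nat \<Rightarrow> nat set set \<Rightarrow> nat \<Rightarrow> memory" where
  "input_memory n E k = (\<lambda>b i.
     if b = 0 \<and> i = 0 then n
     else if b = 1 \<and> i < n * n then of_bool ({i div n, i mod n} \<in> E)
     else if b = 2 \<and> i < floorlog 2 k then 1 + k div 2 ^ i mod 2
     else 0)"

end

theory Submission
  imports Defs "HOL-Analysis.Convex" "HOL-Library.Nat_Bijection"
begin

text \<open>
  For \<open>k \<ge> 2\<close> there are \<open>k\<close> disjoint dominating sets iff some \<open>S\<close> is the disjoint union of \<open>k - 1\<close>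
  dominating sets and has a dominating complement. Such an \<open>S\<close> and all sets involved lie in the
  family \<open>F\<close> of those \<open>X\<close> for which \<open>X\<close> and \<open>V - X\<close> are both dominating. This family is convex, so
  the zeta and Moebius transforms can be computed with a table indexed by \<open>F\<close> alone. With
  \<open>Z = 2 ^ (n * n)\<close>, raising the zeta transform of \<open>Z ^ card X\<close> to the power \<open>k - 1\<close> and inverting it
  gives, at \<open>S\<close>, the sum of \<open>Z ^ (card D\<^sub>1 + \<dots>)\<close> over all \<open>(k - 1)\<close>-tuples with union \<open>S\<close>. No exponent
  is below \<open>card S\<close>, and equality characterises disjoint tuples; as there are fewer than \<open>Z\<close> tuples,
  one exists iff \<open>Z ^ (card S + 1)\<close> does not divide the sum.

  To list \<open>F\<close> in time proportional to the bound, decide the vertices one by one and keep a partial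
  choice \<open>X \<subseteq> {..<i}\<close> as long as no closed neighbourhood is monochromatic already. Shearer's
  inequality, applied to the closed neighbourhoods together with \<open>\<Delta> - deg u\<close> copies of each
  singleton \<open>{u}\<close>, bounds the number \<open>c\<close> of these by
  \<open>c ^ (\<Delta> + 1) \<le> (\<Prod>v. (2 ^ (deg v + 1) - 2) * 2 ^ (\<Delta> - deg v)) \<le> (2 ^ (\<Delta> + 1) - 2) ^ n\<close>.
\<close>

section \<open>A counting form of Shearer's inequality\<close>

text \<open>Superadditivity of the geometric mean. The arithmetic-geometric mean inequality is
  applied to the fractions \<open>a j / (a j + b j)\<close> and to the fractions
  \<open>b j / (a j + b j)\<close>; for each \<open>j\<close> the two add up to 1.\<close>

lemma power_add_le_prod_add:
  fixes a b :: "'j \<Rightarrow> real" and s t :: real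
  assumes J: "finite J" "card J = \<delta>" "\<delta> > 0"
    and nn: "\<And>j. j \<in> J \<Longrightarrow> a j \<ge> 0" "\<And>j. j \<in> J \<Longrightarrow> b j \<ge> 0" "s \<ge> 0" "t \<ge> 0"
    and s: "s ^ \<delta> \<le> (\<Prod>j\<in>J. a j)" and t: "t ^ \<delta> \<le> (\<Prod>j\<in>J. b j)"
  shows "(s + t) ^ \<delta> \<le> (\<Prod>j\<in>J. a j + b j)"
proof (cases "\<exists>j\<in>J. a j + b j = 0")
  \<comment> \<open>A vanishing sum is treated apart because the other case divides by all of them.
    Here both products are 0, which forces \<open>s = t = 0\<close>.\<close>
  case True
  then obtain j where j: "j \<in> J" "a j = 0" "b j = 0"
    using nn by (metis add_nonneg_eq_0_iff)
  then have "(\<Prod>j\<in>J. a j) = 0" "(\<Prod>j\<in>J. b j) = 0" using J by auto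
  then have "s ^ \<delta> \<le> 0" "t ^ \<delta> \<le> 0" using s t by simp_all
  then have "s = 0" "t = 0"
    using nn(3,4) J(3) by (metis zero_le_power order_antisym power_eq_0_iff)+
  then show ?thesis using J nn by (simp add: prod_nonneg zero_power)
next
  case False
  then have pos: "a j + b j > 0" if "j \<in> J" for j
    using nn(1,2)[OF that] that by (metis add_nonneg_nonneg order_le_less)
  define G where "G = root \<delta> (\<Prod>j\<in>J. a j + b j)"
  have Gpos: "G > 0" unfolding G_def using J pos by (simp add: prod_pos)
  have Gpow: "G ^ \<delta> = (\<Prod>j\<in>J. a j + b j)"
    unfolding G_def using J pos by (simp add: prod_pos less_imp_le)
  \<comment> \<open>The pair \<open>a, s\<close> is generalised so that the same estimate serves a
    second time with the roles of \<open>a\<close> and \<open>b\<close> exchanged; \<open>G\<close>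
    depends only on the symmetric product.\<close>
  have key: "s \<le> G * (\<Sum>j\<in>J. a j / (a j + b j)) / \<delta>"
    if nn: "\<And>j. j \<in> J \<Longrightarrow> a j \<ge> 0" "s \<ge> 0"
      and s: "s ^ \<delta> \<le> (\<Prod>j\<in>J. a j)" and pos: "\<And>j. j \<in> J \<Longrightarrow> a j + b j > 0"
      and Gpow: "G ^ \<delta> = (\<Prod>j\<in>J. a j + b j)"
    for a b :: "'j \<Rightarrow> real" and s
  proof -
    have "s / G = root \<delta> ((s / G) ^ \<delta>)"
      using nn(2) Gpos J by (simp add: real_root_power_cancel)
    also have "(s / G) ^ \<delta> \<le> (\<Prod>j\<in>J. a j / (a j + b j))"
      using s Gpos by (simp add: power_divide Gpow prod_dividef divide_right_mono prod_nonneg pos less_imp_le)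
    then have "root \<delta> ((s / G) ^ \<delta>) \<le> root \<delta> (\<Prod>j\<in>J. a j / (a j + b j))"
      using J by simp
    also have "\<dots> = (\<Prod>j\<in>J. a j / (a j + b j)) powr (1 / card J)"
    proof (cases "(\<Prod>j\<in>J. a j / (a j + b j)) = 0")
      case False
      moreover have "(\<Prod>j\<in>J. a j / (a j + b j)) \<ge> 0"
        using nn pos by (intro prod_nonneg) (simp add: less_imp_le)
      ultimately show ?thesis using J by (simp add: root_powr_inverse)
    qed simp
    also have "\<dots> \<le> (\<Sum>j\<in>J. a j / (a j + b j) / card J)"
      using J nn pos by (intro arith_geom_mean) (auto simp: less_imp_le)
    also have "\<dots> = (\<Sum>j\<in>J. a j / (a j + b j)) / \<delta>"
      using J by (simp add: sum_divide_distrib)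
    finally show ?thesis using Gpos J by (simp add: field_simps)
  qed
  have "s + t \<le> G * (\<Sum>j\<in>J. a j / (a j + b j)) / \<delta> + G * (\<Sum>j\<in>J. b j / (b j + a j)) / \<delta>"
    using key[of a s b] key[of b t a] nn s t pos Gpow by (intro add_mono) (auto simp: add.commute)
  also have "\<dots> = G * (\<Sum>j\<in>J. a j / (a j + b j) + b j / (b j + a j)) / \<delta>"
    by (simp add: sum.distrib algebra_simps add_divide_distrib)
  also have "(\<Sum>j\<in>J. a j / (a j + b j) + b j / (b j + a j)) = (\<Sum>j\<in>J. 1)"
    using pos by (intro sum.cong refl) (metis add.commute add_divide_distrib divide_self less_irrefl)
  also have "G * (\<Sum>j\<in>J. 1) / \<delta> = G" using J by simp
  finally show ?thesis using nn by (metis Gpow add_nonneg_nonneg power_mono)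
qed

text \<open>Induction on the ground set. Splitting \<open>F\<close> by membership of
  \<open>x\<close> splits each of the \<delta> traces on sets containing \<open>x\<close> into two
  disjoint parts, so these counts add; the other traces can only grow when passing from a part to
  \<open>F\<close>. Superadditivity of the geometric mean then joins the two induction
  hypotheses.\<close>

lemma card_power_le_prod_projections:
  fixes F :: "'a set set" and A :: "'j \<Rightarrow> 'a set"
  assumes "finite U" "F \<subseteq> Pow U" "finite J" "\<delta> > 0"
    and "\<And>x. x \<in> U \<Longrightarrow> card {j\<in>J. x \<in> A j} = \<delta>"
  shows "card F ^ \<delta> \<le> (\<Prod>j\<in>J. card ((\<lambda>X. X \<inter> A j) ` F))"
  using assms
proof (induction U arbitrary: F rule: finite_induct)
  case empty
  then have "F = {} \<or> F = {{}}" by auto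
  then show ?case using \<open>\<delta> > 0\<close> by (auto simp: zero_power)
next
  case (insert x U)
  define pr where "pr F j = card ((\<lambda>X. X \<inter> A j) ` F)" for F j
  define F0 where "F0 = {X\<in>F. x \<notin> X}"
  \<comment> \<open>Deleting \<open>x\<close> moves this part to the smaller ground set without
    changing its size, since all its members contained \<open>x\<close>.\<close>
  define F1 where "F1 = (\<lambda>X. X - {x}) ` {X\<in>F. x \<in> X}"
  have finF: "finite F" using insert.prems(1) insert.hyps by (meson finite.insertI finite_Pow_iff finite_subset)
  have sub: "F0 \<subseteq> Pow U" "F1 \<subseteq> Pow U"
    unfolding F0_def F1_def using insert.prems(1) by auto
  have IH: "card F0 ^ \<delta> \<le> (\<Prod>j\<in>J. pr F0 j)" "card F1 ^ \<delta> \<le> (\<Prod>j\<in>J. pr F1 j)"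
    unfolding pr_def using insert.IH[OF sub(1)] insert.IH[OF sub(2)] insert.prems by auto
  have cardF: "card F = card F0 + card F1"
  proof -
    have "inj_on (\<lambda>X. X - {x}) {X\<in>F. x \<in> X}" by (auto simp: inj_on_def)
    then have "card F1 = card {X\<in>F. x \<in> X}" unfolding F1_def by (rule card_image)
    moreover have "card F = card ({X\<in>F. x \<notin> X} \<union> {X\<in>F. x \<in> X})" by (rule arg_cong[where f = card]) auto
    ultimately show ?thesis unfolding F0_def using finF by (simp add: card_Un_disjoint disjoint_iff)
  qed
  let ?J = "{j\<in>J. x \<in> A j}"
  have split: "pr F0 j + pr F1 j = pr F j" if "j \<in> ?J" for j
  proof -
    have "(\<lambda>X. X \<inter> A j) ` F = (\<lambda>X. X \<inter> A j) ` F0 \<union> insert x ` ((\<lambda>X. X \<inter> A j) ` F1)" (is "_ = ?P \<union> ?Q")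
      unfolding F0_def F1_def image_image image_Un[symmetric] using that
      by (auto simp: image_iff)
    moreover have "?P \<inter> ?Q = {}" unfolding F0_def by auto
    moreover have "card ?Q = pr F1 j" unfolding pr_def
      by (rule card_image) (auto simp: inj_on_def F1_def)
    moreover have "finite ?P" "finite ?Q" unfolding F0_def F1_def using finF by auto
    ultimately show ?thesis unfolding pr_def by (simp add: card_Un_disjoint)
  qed
  have mono: "pr F0 j \<le> pr F j" "pr F1 j \<le> pr F j" if "j \<in> J - ?J" for j
  proof -
    have "(\<lambda>X. X \<inter> A j) ` F0 \<subseteq> (\<lambda>X. X \<inter> A j) ` F" unfolding F0_def by auto
    moreover have "(\<lambda>X. X \<inter> A j) ` F1 \<subseteq> (\<lambda>X. X \<inter> A j) ` F"
    proof -
      have "(X - {x}) \<inter> A j = X \<inter> A j" for X using that by auto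
      then show ?thesis unfolding F1_def by auto
    qed
    ultimately show "pr F0 j \<le> pr F j" "pr F1 j \<le> pr F j"
      unfolding pr_def using finF by (simp_all add: card_mono)
  qed
  define R where "R = (\<Prod>j\<in>J - ?J. pr F j)"
  have prodsplit: "(\<Prod>j\<in>J. f j) = (\<Prod>j\<in>J - ?J. f j) * (\<Prod>j\<in>?J. f j)" for f :: "'j \<Rightarrow> nat"
    using \<open>finite J\<close> by (intro prod.subset_diff) auto
  have le: "card F0 ^ \<delta> \<le> R * (\<Prod>j\<in>?J. pr F0 j)" "card F1 ^ \<delta> \<le> R * (\<Prod>j\<in>?J. pr F1 j)"
    using IH mono unfolding prodsplit R_def
    by (meson mult_le_mono1 order_trans prod_mono zero_le)+
  have "(real (card F0) + real (card F1)) ^ \<delta> \<le> R * (\<Prod>j\<in>?J. real (pr F j))"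
  proof (cases "R = 0")
    case True
    then show ?thesis using le \<open>\<delta> > 0\<close> by (simp add: zero_power)
  next
    case False
    \<comment> \<open>The common factor \<open>R\<close> comes from the sets avoiding
      \<open>x\<close>. Dividing both sizes by its \<delta>-th root leaves exactly the \<delta>
      factors that the superadditivity lemma accepts.\<close>
    define c where "c = root \<delta> R"
    have c: "c > 0" "c ^ \<delta> = R" unfolding c_def using False \<open>\<delta> > 0\<close> by simp_all
    have "(real (card F0) / c + real (card F1) / c) ^ \<delta> \<le> (\<Prod>j\<in>?J. real (pr F0 j) + real (pr F1 j))"
    proof (rule power_add_le_prod_add)
      show "(real (card F0) / c) ^ \<delta> \<le> (\<Prod>j\<in>?J. real (pr F0 j))"
        using of_nat_mono[OF le(1), where 'a = real] False by (simp add: power_divide c field_simps)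
      show "(real (card F1) / c) ^ \<delta> \<le> (\<Prod>j\<in>?J. real (pr F1 j))"
        using of_nat_mono[OF le(2), where 'a = real] False by (simp add: power_divide c field_simps)
    qed (use c insert.prems in auto)
    also have "\<dots> = (\<Prod>j\<in>?J. real (pr F j))"
      by (intro prod.cong refl) (metis split of_nat_add)
    finally show ?thesis using c False
      by (simp add: add_divide_distrib[symmetric] power_divide field_simps)
  qed
  then have "real (card F ^ \<delta>) \<le> real (R * (\<Prod>j\<in>?J. pr F j))" by (simp add: cardF)
  then show ?case unfolding of_nat_le_iff R_def using prodsplit[of "pr F"] by (simp add: pr_def)
qed

section \<open>Families of balanced prefixes\<close>

definition closed_nbh :: "'a set set \<Rightarrow> 'a \<Rightarrow> 'a set" where
  "closed_nbh E v = insert v (neighbours E v)"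

lemma dominating_set_iff:
  "dominating_set V E D \<longleftrightarrow> D \<subseteq> V \<and> (\<forall>v\<in>V. closed_nbh E v \<inter> D \<noteq> {})"
  unfolding dominating_set_def closed_nbh_def by blast

lemma dominating_set_mono:
  "dominating_set V E D \<Longrightarrow> D \<subseteq> D' \<Longrightarrow> D' \<subseteq> V \<Longrightarrow> dominating_set V E D'"
  unfolding dominating_set_iff by blast

lemma simple_graph_neighbours:
  assumes "simple_graph V E"
  shows "neighbours E v \<subseteq> V" "v \<notin> neighbours E v" "u \<in> neighbours E v \<longleftrightarrow> v \<in> neighbours E u"
  using assms by (auto simp: simple_graph_def neighbours_def insert_commute)

lemma card_neighbours_le_max_degree:
  "finite V \<Longrightarrow> v \<in> V \<Longrightarrow> card (neighbours E v) \<le> max_degree V E"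
  unfolding max_degree_def by (rule Max_ge) auto

lemma card_closed_nbh:
  "simple_graph V E \<Longrightarrow> card (closed_nbh E v) = card (neighbours E v) + 1"
  using simple_graph_neighbours(1,2)[of V E v] finite_subset[of "neighbours E v" V]
  by (simp add: closed_nbh_def simple_graph_def)

text \<open>Undecided vertices are put both into the set and into its complement.\<close>

definition prefix_family :: "nat \<Rightarrow> nat set set \<Rightarrow> nat \<Rightarrow> nat set set" where
  "prefix_family n E i = {X. X \<subseteq> {..<i} \<and> dominating_set {..<n} E (X \<union> {i..<n}) \<and>
     dominating_set {..<n} E ({..<n} - X)}"

lemma finite_prefix_family [simp]: "finite (prefix_family n E i)"
  by (rule finite_subset[of _ "Pow {..<i}"]) (auto simp: prefix_family_def)

text \<open>A closed neighbourhood that is decided completely has neither the empty nor the full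
  trace. One with an undecided vertex may have every trace on its decided part, but these number at
  most \<open>2 ^ d v\<close>, and \<open>2 ^ \<Delta> \<le> 2 ^ (\<Delta> + 1) - 2\<close> because
  \<open>\<Delta> > 0\<close>.\<close>

lemma card_prefix_family_power_le:
  assumes G: "simple_graph {..<n} E" and \<Delta>: "max_degree {..<n} E = \<Delta>" "\<Delta> > 0" and i: "i \<le> n"
  shows "card (prefix_family n E i) ^ (\<Delta> + 1) \<le> (2 ^ (\<Delta> + 1) - 2) ^ n"
proof -
  let ?F = "prefix_family n E i"
  define d where "d v = card (neighbours E v)" for v
  have d: "d v \<le> \<Delta>" if "v < n" for v
    unfolding d_def using card_neighbours_le_max_degree[of "{..<n}" v E] that \<Delta> by simp
  have cN: "card (closed_nbh E v) = d v + 1" for v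
    unfolding d_def by (rule card_closed_nbh[OF G])
  have finN: "finite (closed_nbh E v)" for v
    using cN[of v] card.infinite by fastforce
  have NV: "closed_nbh E v \<subseteq> {..<n}" if "v < n" for v
    using simple_graph_neighbours(1)[OF G] that by (auto simp: closed_nbh_def)
  \<comment> \<open>Index set for the copies of singletons, given to decided vertices only. With
    them every \<open>x < i\<close> is covered exactly \<open>(d x + 1) + (\<Delta> - d x)\<close>
    times.\<close>
  define S where "S = Sigma {..<i} (\<lambda>u. {..<\<Delta> - d u})"
  define A where "A j = (case j of Inl v \<Rightarrow> closed_nbh E v | Inr (u, r) \<Rightarrow> {u})"
    for j :: "nat + nat \<times> nat"
  have finS: "finite S" unfolding S_def by auto
  have "card ?F ^ (\<Delta> + 1) \<le> (\<Prod>j\<in>{..<n} <+> S. card ((\<lambda>X. X \<inter> A j) ` ?F))"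
  proof (rule card_power_le_prod_projections)
    show "?F \<subseteq> Pow {..<i}" by (auto simp: prefix_family_def)
    fix x assume x: "x \<in> {..<i}"
    have "{j \<in> {..<n} <+> S. x \<in> A j} = Inl ` closed_nbh E x \<union> Inr ` ({x} \<times> {..<\<Delta> - d x})"
    proof -
      have "x \<in> closed_nbh E v \<longleftrightarrow> v \<in> closed_nbh E x" for v
        using simple_graph_neighbours(3)[OF G] by (auto simp: closed_nbh_def)
      then show ?thesis using NV[of x] x i by (auto simp: A_def S_def)
    qed
    also have "card \<dots> = \<Delta> + 1"
      using d[of x] x i finN by (subst card_Un_disjoint) (auto simp: card_image cN)
    finally show "card {j \<in> {..<n} <+> S. x \<in> A j} = \<Delta> + 1" .
  qed (use finS in auto)
  also have "\<dots> = (\<Prod>v<n. card ((\<lambda>X. X \<inter> closed_nbh E v) ` ?F)) * (\<Prod>(u, r)\<in>S. card ((\<lambda>X. X \<inter> {u}) ` ?F))"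
    using finS by (subst prod.Plus) (auto simp: A_def split_def)
  also have "(\<Prod>(u, r)\<in>S. card ((\<lambda>X. X \<inter> {u}) ` ?F)) \<le> (\<Prod>(u, r)\<in>S. 2)"
  proof (rule prod_mono, clarify)
    fix u
    have "(\<lambda>X. X \<inter> {u}) ` ?F \<subseteq> {{}, {u}}" by auto
    from card_mono[OF _ this] show "0 \<le> card ((\<lambda>X. X \<inter> {u}) ` ?F) \<and> card ((\<lambda>X. X \<inter> {u}) ` ?F) \<le> 2"
      by simp
  qed
  also have "(\<Prod>(u, r)\<in>S. 2 :: nat) = (\<Prod>u<i. 2 ^ (\<Delta> - d u))"
    unfolding S_def by (subst prod.Sigma[symmetric]) auto
  \<comment> \<open>Padding with factors 1 gives both products the same range, so that they can be
    compared vertex by vertex.\<close>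
  also have "\<dots> = (\<Prod>v<n. if v < i then 2 ^ (\<Delta> - d v) else 1)"
    using i by (subst prod.inter_filter[symmetric]) (auto intro!: prod.cong)
  also have "(\<Prod>v<n. card ((\<lambda>X. X \<inter> closed_nbh E v) ` ?F)) * \<dots> =
      (\<Prod>v<n. card ((\<lambda>X. X \<inter> closed_nbh E v) ` ?F) * (if v < i then 2 ^ (\<Delta> - d v) else 1))"
    by (rule prod.distrib[symmetric])
  also have "\<dots> \<le> (\<Prod>v<n. 2 ^ (\<Delta> + 1) - 2)"
  proof (rule prod_mono, intro conjI)
    fix v assume "v \<in> {..<n}"
    then have v: "v < n" by simp
    let ?N = "closed_nbh E v"
    let ?P = "(\<lambda>X. X \<inter> ?N) ` ?F"
    have pw: "2 ^ d v * 2 ^ (\<Delta> - d v) = (2 :: nat) ^ \<Delta>"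
      using d[OF v] by (simp flip: power_add)
    show "card ?P * (if v < i then 2 ^ (\<Delta> - d v) else 1) \<le> 2 ^ (\<Delta> + 1) - 2"
    proof (cases "?N \<subseteq> {..<i}")
      case True
      have "?P \<subseteq> Pow ?N - {{}, ?N}"
      proof
        fix Y assume "Y \<in> ?P"
        then obtain X where X: "X \<in> ?F" "Y = X \<inter> ?N" by auto
        have "?N \<inter> (X \<union> {i..<n}) \<noteq> {}" "?N \<inter> ({..<n} - X) \<noteq> {}"
          using X v by (auto simp: prefix_family_def dominating_set_iff)
        moreover have "?N \<inter> {i..<n} = {}" using True by auto
        ultimately show "Y \<in> Pow ?N - {{}, ?N}" using X by blast
      qed
      then have "card ?P \<le> card (Pow ?N - {{}, ?N})" using finN by (intro card_mono) auto
      also have "\<dots> = 2 ^ (d v + 1) - 2"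
      proof -
        have "{} \<noteq> ?N" by (simp add: closed_nbh_def)
        then have "card {{}, ?N} = 2" by simp
        then show ?thesis using finN by (subst card_Diff_subset) (auto simp: card_Pow cN)
      qed
      finally have "card ?P * 2 ^ (\<Delta> - d v) \<le> (2 ^ (d v + 1) - 2) * 2 ^ (\<Delta> - d v)" by simp
      \<comment> \<open>The copies of \<open>v\<close> multiply the two missing traces as well; only
        one pair of them is kept in the final bound.\<close>
      also have "\<dots> = 2 ^ (\<Delta> + 1) - 2 * 2 ^ (\<Delta> - d v)"
        using pw by (simp add: diff_mult_distrib mult.assoc)
      also have "\<dots> \<le> 2 ^ (\<Delta> + 1) - 2" by (simp add: diff_le_mono2)
      finally show ?thesis by (auto intro: order_trans[rotated])
    next
      case False
      have "card (?N \<inter> {..<i}) < card ?N"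
        using False finN by (intro psubset_card_mono) auto
      then have "card (?N \<inter> {..<i}) \<le> d v" by (simp add: cN)
      moreover have "?P \<subseteq> Pow (?N \<inter> {..<i})" by (auto simp: prefix_family_def)
      then have "card ?P \<le> 2 ^ card (?N \<inter> {..<i})"
        using finN card_mono[of "Pow (?N \<inter> {..<i})" ?P] by (simp add: card_Pow del: Pow_Int_eq)
      ultimately have "card ?P \<le> 2 ^ d v"
        by (meson one_le_numeral order_trans power_increasing)
      then have "card ?P * 2 ^ (\<Delta> - d v) \<le> 2 ^ \<Delta>"
        unfolding pw[symmetric] by simp
      moreover have "card ?P * (if v < i then 2 ^ (\<Delta> - d v) else 1) \<le> card ?P * 2 ^ (\<Delta> - d v)"
        by (intro mult_le_mono2) simp
      moreover have "(2 :: nat) ^ \<Delta> \<le> 2 ^ (\<Delta> + 1) - 2"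
        using \<open>\<Delta> > 0\<close> self_le_power[of "2::nat" \<Delta>] by simp
      ultimately show ?thesis by linarith
    qed
  qed simp
  finally show ?thesis by simp
qed

text \<open>For \<open>\<Delta> > 0\<close> this is the \<Delta>+1-st root of the previous bound.
  For \<open>\<Delta> = 0\<close> the power is 0 and \<open>max 1\<close> takes over: closed
  neighbourhoods are singletons, hence monochromatic once decided, and only the empty prefix at
  \<open>i = 0\<close> remains.\<close>

lemma card_prefix_family_le:
  assumes G: "simple_graph {..<n} E" and \<Delta>: "max_degree {..<n} E = \<Delta>" and i: "i \<le> n"
  shows "real (card (prefix_family n E i)) \<le> max 1 ((2 ^ (\<Delta> + 1) - 2) powr (real n / real (\<Delta> + 1)))"
proof (cases "\<Delta> = 0")
  case True
  have "prefix_family n E i \<subseteq> {{}}"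
  proof (cases "i = 0")
    case False
    have "finite (neighbours E 0)" "card (neighbours E 0) = 0"
      using card_neighbours_le_max_degree[of "{..<n}" 0 E] simple_graph_neighbours(1)[OF G, of 0]
        finite_subset[of "neighbours E 0" "{..<n}"] False i True \<Delta> by auto
    then have N: "closed_nbh E 0 = {0}" by (simp add: closed_nbh_def)
    have "X \<notin> prefix_family n E i" for X
    proof
      assume "X \<in> prefix_family n E i"
      moreover have "0 \<in> {..<n}" "0 \<notin> {i..<n}" using False i by auto
      ultimately have "{0} \<inter> (X \<union> {i..<n}) \<noteq> {}" "{0} \<inter> ({..<n} - X) \<noteq> {}"
        unfolding prefix_family_def dominating_set_iff mem_Collect_eq by (metis N)+
      then show False using \<open>0 \<notin> {i..<n}\<close> by blast
    qed
    then show ?thesis by blast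
  qed (auto simp: prefix_family_def)
  then have "card (prefix_family n E i) \<le> card {{} :: nat set}" by (intro card_mono) auto
  then show ?thesis by simp
next
  case False
  let ?b = "2 ^ (\<Delta> + 1) - 2 :: real" and ?c = "real (card (prefix_family n E i))"
  have b: "?b > 0" using False power_strict_increasing[of 1 "\<Delta> + 1" "2::real"] by simp
  have ble: "(2::nat) \<le> 2 ^ (\<Delta> + 1)" by simp
  have "real (card (prefix_family n E i) ^ (\<Delta> + 1)) \<le> real ((2 ^ (\<Delta> + 1) - 2) ^ n)"
    using card_prefix_family_power_le[OF G \<Delta> _ i] False of_nat_le_iff by blast
  then have "?c ^ (\<Delta> + 1) \<le> ?b ^ n"
    using ble by (simp add: of_nat_diff del: power_Suc)
  then have "root (\<Delta> + 1) (?c ^ (\<Delta> + 1)) \<le> root (\<Delta> + 1) (?b ^ n)" by simp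
  also have "root (\<Delta> + 1) (?b ^ n) = ?b powr (real n / real (\<Delta> + 1))"
    using b by (simp add: root_powr_inverse powr_powr flip: powr_realpow)
  also have "root (\<Delta> + 1) (?c ^ (\<Delta> + 1)) = ?c" by (rule real_root_power_cancel) auto
  finally show ?thesis by simp
qed

section \<open>Counting covers by Moebius inversion\<close>

text \<open>Interpolates between \<open>w\<close>, for \<open>I = {}\<close>, and its zeta transform, for the whole ground set \<open>I\<close>.\<close>

definition zeta_on :: "'a set set \<Rightarrow> ('a set \<Rightarrow> nat) \<Rightarrow> 'a set \<Rightarrow> 'a set \<Rightarrow> nat" where
  "zeta_on F w I X = (\<Sum>D\<in>{D\<in>F. D \<subseteq> X \<and> X - D \<subseteq> I}. w D)"

definition set_convex :: "'a set set \<Rightarrow> bool" where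
  "set_convex F \<longleftrightarrow> (\<forall>A\<in>F. \<forall>C\<in>F. \<forall>B. A \<subseteq> B \<and> B \<subseteq> C \<longrightarrow> B \<in> F)"

text \<open>The coefficient at \<open>Y\<close> of the \<open>r\<close>-th power of \<open>w\<close>
  under the union product (OR-convolution), with factors taken from \<open>F\<close>.\<close>

definition cover_sum :: "'a set set \<Rightarrow> nat \<Rightarrow> ('a set \<Rightarrow> nat) \<Rightarrow> 'a set \<Rightarrow> nat" where
  "cover_sum F r w Y = (\<Sum>g\<in>{g\<in>{..<r} \<rightarrow>\<^sub>E F. \<Union>(g ` {..<r}) = Y}. \<Prod>j<r. w (g j))"

lemma zeta_on_empty: "X \<in> F \<Longrightarrow> zeta_on F w {} X = w X"
proof -
  assume "X \<in> F"
  then have "{D\<in>F. D \<subseteq> X \<and> X - D \<subseteq> {}} = {X}" by auto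
  then show ?thesis by (simp add: zeta_on_def)
qed

text \<open>The two summands collect the \<open>D\<close> with \<open>i\<close> in \<open>D\<close>
  and those without. From left to right this is one round of Yates' algorithm; solved for the first
  summand it is one round of the inverse.\<close>

lemma zeta_on_insert:
  assumes "finite F" "i \<notin> I" "i \<in> X"
  shows "zeta_on F w (insert i I) X = zeta_on F w I X + zeta_on F w I (X - {i})"
proof -
  have "{D\<in>F. D \<subseteq> X \<and> X - D \<subseteq> insert i I} =
      {D\<in>F. D \<subseteq> X \<and> X - D \<subseteq> I} \<union> {D\<in>F. D \<subseteq> X - {i} \<and> X - {i} - D \<subseteq> I}" (is "_ = ?A \<union> ?B")
    using assms by auto
  moreover have "?A \<inter> ?B = {}" using assms by auto
  ultimately show ?thesis unfolding zeta_on_def using assms(1) by (simp add: sum.union_disjoint)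
qed

lemma zeta_on_insert_notin:
  "i \<notin> X \<Longrightarrow> zeta_on F w (insert i I) X = zeta_on F w I X"
  unfolding zeta_on_def by (intro sum.cong) auto

text \<open>A member of \<open>F\<close> below \<open>Y\<close> would place \<open>Y\<close> between
  two members and hence in \<open>F\<close>. So a table restricted to \<open>F\<close> may read 0 at
  every missing subset of a member.\<close>

lemma zeta_on_outside:
  assumes "set_convex F" "X \<in> F" "Y \<subseteq> X" "Y \<notin> F"
  shows "zeta_on F w I Y = 0"
proof -
  have "{D\<in>F. D \<subseteq> Y \<and> Y - D \<subseteq> I} = {}" using assms unfolding set_convex_def by blast
  then show ?thesis unfolding zeta_on_def by (simp only: sum.empty)
qed

lemma zeta_on_mono: "finite F \<Longrightarrow> I \<subseteq> I' \<Longrightarrow> zeta_on F w I X \<le> zeta_on F w I' X"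
  unfolding zeta_on_def by (intro sum_mono2) auto

text \<open>Expanding the power gives all \<open>r\<close>-tuples of members below \<open>X\<close>,
  which are grouped by their union. The union lies between the entry \<open>g 0\<close> and
  \<open>X\<close>, so convexity puts it in \<open>F\<close>; \<open>r > 0\<close> provides that
  entry.\<close>

lemma zeta_on_power:
  assumes F: "finite F" "set_convex F" and X: "X \<in> F" "X \<subseteq> U" and r: "r > 0"
  shows "zeta_on F w U X ^ r = zeta_on F (cover_sum F r w) U X"
proof -
  let ?S = "{D\<in>F. D \<subseteq> X}"
  have S: "{D\<in>F. D \<subseteq> X \<and> X - D \<subseteq> U} = ?S" using X by auto
  have "zeta_on F w U X ^ r = (\<Prod>j<r. \<Sum>D\<in>?S. w D)" unfolding zeta_on_def S by simp
  also have "\<dots> = (\<Sum>g\<in>{..<r} \<rightarrow>\<^sub>E ?S. \<Prod>j<r. w (g j))" using F by (subst prod_sum_PiE) auto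
  also have "\<dots> = (\<Sum>Y\<in>?S. \<Sum>g\<in>{g\<in>{..<r} \<rightarrow>\<^sub>E ?S. \<Union>(g ` {..<r}) = Y}. \<Prod>j<r. w (g j))"
  proof (rule sum.group[symmetric])
    show "(\<lambda>g. \<Union>(g ` {..<r})) ` ({..<r} \<rightarrow>\<^sub>E ?S) \<subseteq> ?S"
    proof clarify
      fix g assume g: "g \<in> {..<r} \<rightarrow>\<^sub>E ?S"
      have "g j \<in> ?S" if "j < r" for j using g that by (auto simp: PiE_iff)
      then have "g 0 \<in> F" "g 0 \<subseteq> \<Union>(g ` {..<r})" "\<Union>(g ` {..<r}) \<subseteq> X" using r by auto
      then show "\<Union>(g ` {..<r}) \<in> F \<and> \<Union>(g ` {..<r}) \<subseteq> X"
        using F X unfolding set_convex_def by blast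
    qed
  qed (use F in \<open>auto intro!: finite_PiE\<close>)
  also have "\<dots> = (\<Sum>Y\<in>?S. cover_sum F r w Y)"
    unfolding cover_sum_def
  proof (rule sum.cong[OF refl], rule sum.cong[OF _ refl])
    fix Y assume "Y \<in> ?S"
    then show "{g\<in>{..<r} \<rightarrow>\<^sub>E ?S. \<Union>(g ` {..<r}) = Y} = {g\<in>{..<r} \<rightarrow>\<^sub>E F. \<Union>(g ` {..<r}) = Y}"
      by (auto simp: PiE_iff)
  qed
  finally show ?thesis unfolding zeta_on_def S .
qed

text \<open>Modulo \<open>Z ^ (card Y + 1)\<close> only tuples of minimal total size survive, each
  contributing \<open>Z ^ card Y\<close>. The bound on \<open>card F ^ r\<close> keeps their number
  from vanishing modulo \<open>Z\<close>.\<close>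

lemma cover_sum_mod:
  assumes F: "finite F" "\<And>D. D \<in> F \<Longrightarrow> finite D" and Z: "card F ^ r < Z"
  shows "cover_sum F r (\<lambda>D. Z ^ card D) Y mod (Z ^ card Y * Z) \<noteq> 0 \<longleftrightarrow>
    (\<exists>g\<in>{..<r} \<rightarrow>\<^sub>E F. \<Union>(g ` {..<r}) = Y \<and> (\<Sum>j<r. card (g j)) = card Y)"
proof -
  define T where "T = {g\<in>{..<r} \<rightarrow>\<^sub>E F. \<Union>(g ` {..<r}) = Y}"
  define T0 where "T0 = {g\<in>T. (\<Sum>j<r. card (g j)) = card Y}"
  have fin: "finite ({..<r} \<rightarrow>\<^sub>E F)" using F by (intro finite_PiE) auto
  then have "finite T" unfolding T_def by simp
  have le: "card Y \<le> (\<Sum>j<r. card (g j))" if "g \<in> T" for g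
    using card_UN_le[of "{..<r}" g] that by (auto simp: T_def)
  have "cover_sum F r (\<lambda>D. Z ^ card D) Y = (\<Sum>g\<in>T. Z ^ (\<Sum>j<r. card (g j)))"
    unfolding cover_sum_def T_def by (simp add: power_sum)
  also have "\<dots> = (\<Sum>g\<in>T - T0. Z ^ (\<Sum>j<r. card (g j))) + (\<Sum>g\<in>T0. Z ^ (\<Sum>j<r. card (g j)))"
    using \<open>finite T\<close> by (intro sum.subset_diff) (auto simp: T0_def)
  also have "(\<Sum>g\<in>T0. Z ^ (\<Sum>j<r. card (g j))) = card T0 * Z ^ card Y" by (simp add: T0_def)
  finally have eq: "cover_sum F r (\<lambda>D. Z ^ card D) Y =
    (\<Sum>g\<in>T - T0. Z ^ (\<Sum>j<r. card (g j))) + card T0 * Z ^ card Y" .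
  have "Z ^ card Y * Z dvd (\<Sum>g\<in>T - T0. Z ^ (\<Sum>j<r. card (g j)))"
  proof (rule dvd_sum)
    fix g assume g: "g \<in> T - T0"
    then have "card Y + 1 \<le> (\<Sum>j<r. card (g j))" using le[of g] by (auto simp: T0_def)
    then have "Z ^ (card Y + 1) dvd Z ^ (\<Sum>j<r. card (g j))" by (rule le_imp_power_dvd)
    then show "Z ^ card Y * Z dvd Z ^ (\<Sum>j<r. card (g j))" by (simp add: mult.commute)
  qed
  then obtain q where q: "(\<Sum>g\<in>T - T0. Z ^ (\<Sum>j<r. card (g j))) = Z ^ card Y * Z * q" ..
  then have "cover_sum F r (\<lambda>D. Z ^ card D) Y mod (Z ^ card Y * Z) =
      (Z ^ card Y * card T0) mod (Z ^ card Y * Z)"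
    unfolding eq q by (simp only: mod_mult_self4 mult.commute[of "card T0" "Z ^ card Y"])
  also have "\<dots> = Z ^ card Y * (card T0 mod Z)" by (rule mult_mod_right[symmetric])
  also have "card T0 mod Z = card T0"
  proof (rule mod_less)
    have "card T0 \<le> card ({..<r} \<rightarrow>\<^sub>E F)" using fin by (intro card_mono) (auto simp: T0_def T_def)
    then show "card T0 < Z" using Z by (simp add: card_PiE)
  qed
  finally have "cover_sum F r (\<lambda>D. Z ^ card D) Y mod (Z ^ card Y * Z) \<noteq> 0 \<longleftrightarrow> card T0 \<noteq> 0"
    using Z by simp
  also have "\<dots> \<longleftrightarrow> T0 \<noteq> {}" using \<open>finite T\<close> by (simp add: T0_def)
  also have "\<dots> \<longleftrightarrow> (\<exists>g\<in>{..<r} \<rightarrow>\<^sub>E F. \<Union>(g ` {..<r}) = Y \<and> (\<Sum>j<r. card (g j)) = card Y)"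
    by (auto simp: T0_def T_def)
  finally show ?thesis .
qed

section \<open>Packings as disjoint covers by balanced sets\<close>

lemma set_convex_prefix_family: "set_convex (prefix_family n E n)"
  unfolding set_convex_def
proof (intro ballI allI impI, elim conjE)
  fix A B C assume *: "A \<in> prefix_family n E n" "C \<in> prefix_family n E n" "A \<subseteq> B" "B \<subseteq> C"
  have "dominating_set {..<n} E B"
    by (rule dominating_set_mono[of _ _ A]) (use * in \<open>auto simp: prefix_family_def\<close>)
  moreover have "dominating_set {..<n} E ({..<n} - B)"
    by (rule dominating_set_mono[of _ _ "{..<n} - C"]) (use * in \<open>auto simp: prefix_family_def\<close>)
  ultimately show "B \<in> prefix_family n E n" using * by (auto simp: prefix_family_def)
qed

text \<open>Disjoint nonempty subsets of \<open>{..<n}\<close> number at most \<open>n\<close>. The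
  empty set dominates only if \<open>n = 0\<close>, and then it is the only possible member,
  contrary to \<open>k \<ge> 2\<close>.\<close>

lemma dominating_packing_le:
  assumes P: "has_dominating_packing {..<n} E k" and k: "k \<ge> 2"
  shows "k \<le> n"
proof -
  obtain P where P: "\<And>D. D \<in> P \<Longrightarrow> dominating_set {..<n} E D" "finite P" "card P = k" "disjoint P"
    using P by (auto simp: has_dominating_packing_def)
  have sub: "D \<subseteq> {..<n}" if "D \<in> P" for D using P(1)[OF that] by (simp add: dominating_set_def)
  have "{} \<notin> P"
  proof
    assume "{} \<in> P"
    from P(1)[OF this] have "n = 0" by (auto simp: dominating_set_def)
    then have "P \<subseteq> {{}}" using sub by auto
    then have "card P \<le> card {{} :: nat set}" by (intro card_mono) auto
    then show False using P k by simp
  qed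
  have fin: "finite D" if "D \<in> P" for D using sub[OF that] finite_subset by blast
  have "card P = (\<Sum>D\<in>P. 1)" by simp
  also have "\<dots> \<le> (\<Sum>D\<in>P. card D)"
    using \<open>{} \<notin> P\<close> fin by (intro sum_mono) (metis One_nat_def Suc_leI card_gt_0_iff)
  also have "\<dots> = card (\<Union>P)"
    using P fin by (intro card_Union_disjoint[symmetric]) (auto simp: disjoint_def pairwise_def disjnt_def)
  also have "\<dots> \<le> card {..<n}" using sub by (intro card_mono) auto
  finally show ?thesis using P by simp
qed

text \<open>The projection from the disjoint sum of the \<open>g j\<close> onto their union is a
  surjection between finite sets of equal size, hence injective.\<close>

lemma disjoint_of_sum_card:
  fixes r :: nat
  assumes "\<And>j. j < r \<Longrightarrow> finite (g j)" "(\<Sum>j<r. card (g j)) = card (\<Union>(g ` {..<r}))"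
    and "i < r" "j < r" "i \<noteq> j"
  shows "g i \<inter> g j = {}"
proof -
  let ?S = "SIGMA j:{..<r}. g j"
  have "card ?S = card (\<Union>(g ` {..<r}))" using assms(2) by (subst card_SigmaI) (auto simp: assms(1))
  moreover have "snd ` ?S = \<Union>(g ` {..<r})" by force
  ultimately have "inj_on snd ?S" using assms(1) by (intro eq_card_imp_inj_on) auto
  then show ?thesis using assms(3-5) by (force simp: inj_on_def)
qed

text \<open>One set of the packing is held back and the union of the others is \<open>S\<close>;
  conversely \<open>{..<n} - S\<close> is added to the tuple. As \<open>n > 0\<close>, dominating
  sets are nonempty, so disjoint ones are distinct and the cardinality is exactly
  \<open>k\<close>.\<close>

lemma has_dominating_packing_iff:
  assumes k: "k \<ge> 2" and n: "n > 0"
  shows "has_dominating_packing {..<n} E k \<longleftrightarrow>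
    (\<exists>S\<in>prefix_family n E n. \<exists>g\<in>{..<k - 1} \<rightarrow>\<^sub>E prefix_family n E n.
      \<Union>(g ` {..<k - 1}) = S \<and> (\<Sum>j<k - 1. card (g j)) = card S)" (is "_ \<longleftrightarrow> ?rhs")
proof
  let ?V = "{..<n}"
  have F: "X \<in> prefix_family n E n \<longleftrightarrow> X \<subseteq> ?V \<and> dominating_set ?V E X \<and> dominating_set ?V E (?V - X)" for X
    by (auto simp: prefix_family_def)
  {
    assume "has_dominating_packing ?V E k"
    then obtain P where P: "\<And>D. D \<in> P \<Longrightarrow> dominating_set ?V E D" "finite P" "card P = k" "disjoint P"
      by (auto simp: has_dominating_packing_def)
    obtain h where h: "bij_betw h {..<k} P"
      using P ex_bij_betw_nat_finite[of P] by (auto simp: atLeast0LessThan)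
    have dom: "dominating_set ?V E (h j)" if "j < k" for j
      using P(1) h that by (auto simp: bij_betw_def)
    then have sub: "h j \<subseteq> ?V" if "j < k" for j using that by (auto simp: dominating_set_def)
    then have fin: "finite (h j)" if "j < k" for j using that by (meson finite_lessThan finite_subset)
    have disj: "h i \<inter> h j = {}" if "i < k" "j < k" "i \<noteq> j" for i j
    proof -
      have "h i \<noteq> h j" "h i \<in> P" "h j \<in> P" using h that by (auto simp: bij_betw_def inj_on_def)
      then show ?thesis using P(4) by (simp add: disjointD)
    qed
    let ?S = "\<Union>(h ` {..<k - 1})"
    have Ssub: "?S \<subseteq> ?V" by (rule UN_least, rule sub) simp
    \<comment> \<open>Serves both \<open>S\<close> and the single sets \<open>h j\<close>: each
      contains a dominating set, and its complement contains the set \<open>h (k - 1)\<close> held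
      back.\<close>
    have inF: "X \<in> prefix_family n E n" if X: "X \<subseteq> ?S" "h j \<subseteq> X" "j < k - 1" for X j
    proof -
      have "dominating_set ?V E X"
        using dominating_set_mono[OF dom[of j]] X Ssub by auto
      moreover have "h (k - 1) \<inter> h i = {}" if "i < k - 1" for i
        using disj[of "k - 1" i] that k by simp
      then have "h (k - 1) \<inter> X = {}" using X(1) by blast
      then have "h (k - 1) \<subseteq> ?V - X" using sub[of "k - 1"] k by auto
      then have "dominating_set ?V E (?V - X)"
        using dominating_set_mono[OF dom[of "k - 1"]] k by auto
      ultimately show ?thesis using X(1) Ssub F by blast
    qed
    have "?S \<in> prefix_family n E n" using k by (intro inF[of _ 0] subset_refl UN_upper) auto
    moreover have "restrict h {..<k - 1} \<in> {..<k - 1} \<rightarrow>\<^sub>E prefix_family n E n"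
      using inF by auto
    moreover have "(\<Sum>j<k - 1. card (h j)) = card ?S"
      using fin disj by (subst card_UN_disjoint) auto
    ultimately show ?rhs by (intro bexI[of _ ?S] bexI[of _ "restrict h {..<k - 1}"]) auto
  }
  assume ?rhs
  then obtain S g where S: "S \<in> prefix_family n E n" and g: "g \<in> {..<k - 1} \<rightarrow>\<^sub>E prefix_family n E n"
    and gS: "\<Union>(g ` {..<k - 1}) = S" and card: "(\<Sum>j<k - 1. card (g j)) = card S" by blast
  have gF: "g j \<in> prefix_family n E n" if "j < k - 1" for j using g that by auto
  have fin: "finite (g j)" if "j < k - 1" for j
    using gF[OF that] by (auto simp: F intro: finite_subset)
  have ne: "X \<noteq> {}" if "dominating_set ?V E X" for X using that n by (auto simp: dominating_set_def)
  have disj: "g i \<inter> g j = {}" if "i < k - 1" "j < k - 1" "i \<noteq> j" for i j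
    using disjoint_of_sum_card[of "k - 1" g] fin card gS that by simp
  have "inj_on g {..<k - 1}"
  proof (rule inj_onI, rule ccontr)
    fix i j assume ij: "i \<in> {..<k - 1}" "j \<in> {..<k - 1}" "g i = g j" "i \<noteq> j"
    then have "g i = {}" using disj[of i j] by auto
    then show False using ne[of "g i"] gF[of i] ij F by auto
  qed
  then have cg: "card (g ` {..<k - 1}) = k - 1" by (simp add: card_image)
  have "?V - S \<notin> g ` {..<k - 1}"
  proof
    assume "?V - S \<in> g ` {..<k - 1}"
    then have "?V - S \<subseteq> S" using gS by blast
    then have "?V - S = {}" by blast
    then show False using S ne F by metis
  qed
  then have "card (insert (?V - S) (g ` {..<k - 1})) = k" using cg k by simp
  moreover have "disjoint (insert (?V - S) (g ` {..<k - 1}))"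
  proof (rule disjointI)
    fix A B assume AB: "A \<in> insert (?V - S) (g ` {..<k - 1})" "B \<in> insert (?V - S) (g ` {..<k - 1})" "A \<noteq> B"
    have "(?V - S) \<inter> g j = {}" if "j < k - 1" for j using that gS by blast
    moreover have "A = ?V - S \<or> (\<exists>i<k - 1. A = g i)" "B = ?V - S \<or> (\<exists>i<k - 1. B = g i)"
      using AB by auto
    ultimately show "A \<inter> B = {}" using disj AB(3) by (metis Int_commute)
  qed
  ultimately show "has_dominating_packing ?V E k"
    unfolding has_dominating_packing_def using S gF F
    by (intro exI[of _ "insert (?V - S) (g ` {..<k - 1})"]) auto
qed

section \<open>Cost of programs\<close>

lemma len_pos [simp]: "Suc 0 \<le> len x" by (simp add: len_def)

lemma len_le_iff: "1 \<le> L \<Longrightarrow> len x \<le> L \<longleftrightarrow> x < 2 ^ L"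
  by (simp add: len_def floorlog_le_iff)

lemma less_power_len: "x < 2 ^ len x"
  using len_le_iff[of "len x" x] by simp

lemma len_add_le: "len (x + y) \<le> len x + len y"
proof -
  have "x + y < 2 ^ len x + 2 ^ len y" using less_power_len by (simp add: add_strict_mono)
  also have "\<dots> \<le> 2 ^ len x * (2 ^ len y :: nat)"
  proof -
    have "p + q \<le> p * q" if pq: "2 \<le> p" "2 \<le> q" for p q :: nat
    proof -
      obtain a b where "p = 2 + a" "q = 2 + b" using pq by (auto simp: le_iff_add)
      then show ?thesis by simp
    qed
    moreover have "(2::nat) ^ 1 \<le> 2 ^ len z" for z by (rule power_increasing) simp_all
    ultimately show ?thesis by simp
  qed
  finally show ?thesis using len_pos[of x] by (subst len_le_iff) (simp_all add: power_add trans_le_add1)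
qed

lemma len_mult_le: "len (x * y) \<le> len x + len y"
proof -
  have "x * y < 2 ^ len x * 2 ^ len y" using less_power_len by (simp add: mult_strict_mono)
  then show ?thesis using len_pos[of x] by (subst len_le_iff) (simp_all add: power_add trans_le_add1)
qed

lemma len_mono: "x \<le> y \<Longrightarrow> len x \<le> len y"
  unfolding len_def by (meson floorlog_mono max.mono order_refl)

text \<open>A value has at most \<open>expr_weight e * L\<close> bits if all cells have at most
  \<open>L\<close>. For \<open>Load\<close> the 1 already covers the value; the remaining summand
  pays for the address.\<close>

fun expr_weight :: "expr \<Rightarrow> nat" where
  "expr_weight (Num c) = len c"
| "expr_weight (Load b e) = expr_weight e + 1"
| "expr_weight (Add e f) = expr_weight e + expr_weight f"
| "expr_weight (Sub e f) = expr_weight e + expr_weight f"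
| "expr_weight (Mul e f) = expr_weight e + expr_weight f"
| "expr_weight (Div e f) = expr_weight e + expr_weight f"

lemma expr_weight_pos: "Suc 0 \<le> expr_weight e"
  by (induction e) auto

definition bounded_memory :: "nat \<Rightarrow> memory \<Rightarrow> bool" where
  "bounded_memory L m \<longleftrightarrow> 1 \<le> L \<and> (\<forall>b a. m b a < 2 ^ L)"

lemma len_eval_expr_le:
  assumes "bounded_memory L m"
  shows "len (eval_expr e m) \<le> expr_weight e * L"
proof (induction e)
  case (Num c)
  then show ?case using assms mult_le_mono2[of 1 L "len c"] by (simp add: bounded_memory_def)
next
  case (Load b e)
  have "len (m b (eval_expr e m)) \<le> L" using assms by (simp add: bounded_memory_def len_le_iff)
  then show ?case by simp
next
  case (Add e f)
  then show ?case using len_add_le[of "eval_expr e m" "eval_expr f m"] by (simp add: distrib_right)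
next
  case (Sub e f)
  then show ?case using len_mono[of "eval_expr e m - eval_expr f m" "eval_expr e m"]
    by (simp add: distrib_right)
next
  case (Mul e f)
  then show ?case using len_mult_le[of "eval_expr e m" "eval_expr f m"] by (simp add: distrib_right)
next
  case (Div e f)
  then show ?case using len_mono[of "eval_expr e m div eval_expr f m" "eval_expr e m"]
    by (simp add: distrib_right)
qed

text \<open>The cross term \<open>4 * (p * q)\<close> of the square absorbs the charge of one
  operation, whether the sum or the product of the operand lengths.\<close>

lemma sum_le_square_add:
  fixes p q :: nat
  assumes "1 \<le> p" "1 \<le> q" "a \<le> 2 * p\<^sup>2" "b \<le> 2 * q\<^sup>2" "x \<le> p" "y \<le> q"
  shows "a + b + x + y \<le> 2 * (p + q)\<^sup>2" "a + b + x * y \<le> 2 * (p + q)\<^sup>2"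
proof -
  have "p * 1 \<le> p * q" by (rule mult_le_mono2) (rule assms)
  moreover have "1 * q \<le> p * q" by (rule mult_le_mono1) (rule assms)
  moreover have "x * y \<le> p * q" using assms by (intro mult_le_mono)
  moreover have "2 * (p + q)\<^sup>2 = 2 * p\<^sup>2 + 2 * q\<^sup>2 + 4 * (p * q)"
    by (simp add: power2_sum algebra_simps)
  ultimately show "a + b + x + y \<le> 2 * (p + q)\<^sup>2" "a + b + x * y \<le> 2 * (p + q)\<^sup>2"
    using assms by linarith+
qed

lemma cost_expr_le:
  assumes "bounded_memory L m"
  shows "cost_expr e m \<le> 2 * (expr_weight e * L)\<^sup>2"
proof -
  have L: "1 \<le> L" using assms by (simp add: bounded_memory_def)
  have w: "1 \<le> expr_weight e * L" for e using L expr_weight_pos[of e] by (simp add: Suc_le_eq)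
  show ?thesis
  proof (induction e)
    case (Num c)
    have "len c * 1 \<le> len c * L" using L by (intro mult_le_mono2)
    moreover have "len c * L \<le> (len c * L)\<^sup>2" using w[of "Num c"] by (intro self_le_power) simp_all
    ultimately show ?case unfolding cost_expr.simps expr_weight.simps by linarith
  next
    case (Load b e)
    have "len (m b (eval_expr e m)) \<le> L" using assms by (simp add: bounded_memory_def len_le_iff)
    then have "cost_expr e m + 0 + len (eval_expr e m) + len (m b (eval_expr e m)) \<le> 2 * (expr_weight e * L + L)\<^sup>2"
      using Load len_eval_expr_le[OF assms] L by (intro sum_le_square_add(1) w) auto
    then show ?case by (simp add: algebra_simps)
  qed (simp_all only: cost_expr.simps expr_weight.simps distrib_right,
      (intro sum_le_square_add w len_eval_expr_le[OF assms]; assumption)+)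
qed

section \<open>Rules for proving results and costs of programs\<close>

fun prog_weight :: "prog \<Rightarrow> nat" where
  "prog_weight Skip = 1"
| "prog_weight (Store b e f) = 2 * (expr_weight e + expr_weight f)\<^sup>2"
| "prog_weight (Seq p q) = prog_weight p + prog_weight q"
| "prog_weight (If e p q) = 2 * (expr_weight e)\<^sup>2 + 1 + prog_weight p + prog_weight q"
| "prog_weight (While e p) = 2 * (expr_weight e)\<^sup>2 + 1 + prog_weight p"

text \<open>Since \<open>prog_weight\<close> depends on the program text only, \<open>s\<close> merely has to bound the total
  number of loop iterations; all costs of arithmetic are absorbed by \<open>L\<close>, which bounds the length of
  every cell at all times.\<close>

definition runs :: "nat \<Rightarrow> prog \<Rightarrow> memory \<Rightarrow> nat \<Rightarrow> (memory \<Rightarrow> bool) \<Rightarrow> bool" where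
  "runs L p m s Q \<longleftrightarrow> (bounded_memory L m \<longrightarrow>
     (\<exists>t m'. exec p m t m' \<and> t \<le> prog_weight p * L\<^sup>2 * (s + 1) \<and> bounded_memory L m' \<and> Q m'))"

lemma runs_mono:
  assumes "runs L p m s Q" "\<And>m'. Q m' \<Longrightarrow> Q' m'" "s \<le> s'"
  shows "runs L p m s' Q'"
proof -
  have "prog_weight p * L\<^sup>2 * (s + 1) \<le> prog_weight p * L\<^sup>2 * (s' + 1)"
    using assms(3) by (intro mult_le_mono2) simp
  then show ?thesis using assms(1,2) unfolding runs_def by (meson order_trans)
qed

lemma runs_Skip: "Q m \<Longrightarrow> runs L Skip m s Q"
  unfolding runs_def
proof
  assume "Q m" "bounded_memory L m"
  then have "1 * 1 \<le> L\<^sup>2 * (s + 1)" by (intro mult_le_mono) (simp_all add: bounded_memory_def)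
  then show "\<exists>t m'. exec Skip m t m' \<and> t \<le> prog_weight Skip * L\<^sup>2 * (s + 1) \<and> bounded_memory L m' \<and> Q m'"
    using \<open>Q m\<close> \<open>bounded_memory L m\<close> exec.Skip by (intro exI[of _ 1] exI[of _ m]) simp
qed

lemma runs_Store:
  assumes "eval_expr f m < 2 ^ L" "Q (m(b := (m b)(eval_expr e m := eval_expr f m)))"
  shows "runs L (Store b e f) m s Q"
  unfolding runs_def
proof
  assume B: "bounded_memory L m"
  let ?t = "cost_expr e m + cost_expr f m + len (eval_expr e m) + len (eval_expr f m)"
  let ?p = "expr_weight e * L" and ?q = "expr_weight f * L"
  have w: "1 \<le> expr_weight e * L" for e
    using B expr_weight_pos[of e] by (simp add: Suc_le_eq bounded_memory_def)
  have "?t \<le> 2 * (?p + ?q)\<^sup>2"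
    by (intro sum_le_square_add w cost_expr_le len_eval_expr_le B)
  also have "\<dots> = 2 * (expr_weight e + expr_weight f)\<^sup>2 * L\<^sup>2 * 1"
    by (simp add: distrib_right[symmetric] power_mult_distrib)
  also have "\<dots> \<le> 2 * (expr_weight e + expr_weight f)\<^sup>2 * L\<^sup>2 * (s + 1)"
    by (intro mult_le_mono2) simp
  finally have "?t \<le> prog_weight (Store b e f) * L\<^sup>2 * (s + 1)" by simp
  moreover have "bounded_memory L (m(b := (m b)(eval_expr e m := eval_expr f m)))"
    using B assms(1) by (simp add: bounded_memory_def)
  ultimately show "\<exists>t m'. exec (Store b e f) m t m' \<and> t \<le> prog_weight (Store b e f) * L\<^sup>2 * (s + 1) \<and>
      bounded_memory L m' \<and> Q m'"
    using assms(2) exec.Store by blast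
qed

lemma runs_Seq:
  assumes "runs L p m s\<^sub>1 R" "\<And>m'. R m' \<Longrightarrow> runs L q m' s\<^sub>2 Q" "s\<^sub>1 + s\<^sub>2 \<le> s"
  shows "runs L (Seq p q) m s Q"
  unfolding runs_def
proof
  assume "bounded_memory L m"
  then obtain t m' where 1: "exec p m t m'" "t \<le> prog_weight p * L\<^sup>2 * (s\<^sub>1 + 1)" "bounded_memory L m'" "R m'"
    using assms(1) unfolding runs_def by blast
  then obtain t' m'' where 2: "exec q m' t' m''" "t' \<le> prog_weight q * L\<^sup>2 * (s\<^sub>2 + 1)"
      "bounded_memory L m''" "Q m''"
    using assms(2) unfolding runs_def by blast
  have "prog_weight p * L\<^sup>2 * (s\<^sub>1 + 1) \<le> prog_weight p * L\<^sup>2 * (s + 1)"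
    "prog_weight q * L\<^sup>2 * (s\<^sub>2 + 1) \<le> prog_weight q * L\<^sup>2 * (s + 1)"
    using assms(3) by (intro mult_le_mono2; simp)+
  then have "t + t' \<le> prog_weight (Seq p q) * L\<^sup>2 * (s + 1)"
    using 1(2) 2(2) unfolding prog_weight.simps distrib_right by linarith
  then show "\<exists>t m'. exec (Seq p q) m t m' \<and> t \<le> prog_weight (Seq p q) * L\<^sup>2 * (s + 1) \<and>
      bounded_memory L m' \<and> Q m'"
    using exec.Seq[OF 1(1) 2(1)] 2(3,4) by blast
qed

lemma runs_Store_Seq:
  assumes "eval_expr f m < 2 ^ L" "runs L q (m(b := (m b)(eval_expr e m := eval_expr f m))) s Q"
  shows "runs L (Seq (Store b e f) q) m s Q"
  by (rule runs_Seq[where R = "\<lambda>m'. m' = m(b := (m b)(eval_expr e m := eval_expr f m))" and s\<^sub>1 = 0])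
    (use assms in \<open>auto intro: runs_Store\<close>)

lemma runs_If:
  assumes "eval_expr e m \<noteq> 0 \<Longrightarrow> runs L p m s Q" "eval_expr e m = 0 \<Longrightarrow> runs L q m s Q"
  shows "runs L (If e p q) m s Q"
  unfolding runs_def
proof
  assume B: "bounded_memory L m"
  let ?c = "2 * (expr_weight e)\<^sup>2 + 1"
  have "cost_expr e m + 1 \<le> ?c * L\<^sup>2"
  proof -
    have "1 \<le> L\<^sup>2" using B by (simp add: bounded_memory_def)
    then show ?thesis using cost_expr_le[OF B, of e] by (simp add: power_mult_distrib distrib_right)
  qed
  also have "?c * L\<^sup>2 * 1 \<le> ?c * L\<^sup>2 * (s + 1)" by (intro mult_le_mono2) simp
  finally have c: "cost_expr e m + 1 \<le> ?c * L\<^sup>2 * (s + 1)" by simp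
  show "\<exists>t m'. exec (If e p q) m t m' \<and> t \<le> prog_weight (If e p q) * L\<^sup>2 * (s + 1) \<and>
      bounded_memory L m' \<and> Q m'"
  proof (cases "eval_expr e m = 0")
    case True
    then obtain t m' where "exec q m t m'" "t \<le> prog_weight q * L\<^sup>2 * (s + 1)" "bounded_memory L m'" "Q m'"
      using assms(2) B by (auto simp: runs_def)
    moreover from this c have "cost_expr e m + t + 1 \<le> prog_weight (If e p q) * L\<^sup>2 * (s + 1)"
      by (simp add: distrib_right)
    ultimately show ?thesis using exec.IfFalse[OF True] by blast
  next
    case False
    then obtain t m' where "exec p m t m'" "t \<le> prog_weight p * L\<^sup>2 * (s + 1)" "bounded_memory L m'" "Q m'"
      using assms(1) B by (auto simp: runs_def)
    moreover from this c have "cost_expr e m + t + 1 \<le> prog_weight (If e p q) * L\<^sup>2 * (s + 1)"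
      by (simp add: distrib_right)
    ultimately show ?thesis using exec.IfTrue[OF False] by blast
  qed
qed

text \<open>Induction on the number of remaining rounds. Each round is counted as
  \<open>s + 1\<close>, for its inner loops and itself; the last, failing test is paid by the
  \<open>+ 1\<close> built into \<open>runs\<close>.\<close>

lemma runs_While:
  assumes "I 0 m" "\<And>i m. i < N \<Longrightarrow> I i m \<Longrightarrow> eval_expr e m \<noteq> 0 \<and> runs L p m s (I (Suc i))"
    "\<And>m. I N m \<Longrightarrow> eval_expr e m = 0"
  shows "runs L (While e p) m (N * (s + 1)) (I N)"
proof -
  let ?c = "2 * (expr_weight e)\<^sup>2 + 1" and ?W = "prog_weight (While e p)"
  have c: "cost_expr e m + 1 \<le> ?c * L\<^sup>2" if "bounded_memory L m" for m
  proof -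
    have "1 \<le> L\<^sup>2" using that by (simp add: bounded_memory_def)
    then show ?thesis using cost_expr_le[OF that, of e] by (simp add: power_mult_distrib distrib_right)
  qed
  have "runs L (While e p) m (j * (s + 1)) (I N)" if "j \<le> N" "I (N - j) m" for j m
    using that
  proof (induction j arbitrary: m)
    case 0
    have "\<exists>t m'. exec (While e p) m t m' \<and> t \<le> ?W * L\<^sup>2 * (0 * (s + 1) + 1) \<and> bounded_memory L m' \<and> I N m'"
      if B: "bounded_memory L m"
    proof -
      have "cost_expr e m + 1 \<le> ?W * L\<^sup>2 * (0 * (s + 1) + 1)"
        using c[OF B] by (simp add: distrib_right)
      moreover have "eval_expr e m = 0" using assms(3) 0 by simp
      ultimately show ?thesis using exec.WhileFalse[of e m p] 0 B
        by (intro exI[of _ "cost_expr e m + 1"] exI[of _ m]) simp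
    qed
    then show ?case unfolding runs_def by blast
  next
    case (Suc j)
    have st: "eval_expr e m \<noteq> 0" "runs L p m s (I (Suc (N - Suc j)))"
      using assms(2)[OF _ Suc.prems(2)] Suc.prems(1) by auto
    have "Suc (N - Suc j) = N - j" using Suc.prems(1) by simp
    show ?case unfolding runs_def
    proof
      assume B: "bounded_memory L m"
      then obtain t m' where 1: "exec p m t m'" "t \<le> prog_weight p * L\<^sup>2 * (s + 1)" "bounded_memory L m'" "I (N - j) m'"
        using st(2) unfolding runs_def \<open>Suc (N - Suc j) = N - j\<close> by blast
      then obtain t' m'' where 2: "exec (While e p) m' t' m''" "t' \<le> ?W * L\<^sup>2 * (j * (s + 1) + 1)"
          "bounded_memory L m''" "I N m''"
        using Suc.IH[OF Suc_leD[OF Suc.prems(1)], of m'] unfolding runs_def by blast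
      have "?c * L\<^sup>2 * 1 \<le> ?c * L\<^sup>2 * (s + 1)" by (intro mult_le_mono2) simp
      then have "cost_expr e m + t + 1 \<le> ?W * L\<^sup>2 * (s + 1)"
        using c[OF B] 1(2) by (simp add: distrib_right)
      then have "cost_expr e m + t + t' + 1 \<le> ?W * L\<^sup>2 * (s + 1) + ?W * L\<^sup>2 * (j * (s + 1) + 1)"
        using 2(2) by linarith
      also have "\<dots> = ?W * L\<^sup>2 * (Suc j * (s + 1) + 1)" by (simp add: algebra_simps)
      finally show "\<exists>t m'. exec (While e p) m t m' \<and> t \<le> ?W * L\<^sup>2 * (Suc j * (s + 1) + 1) \<and>
          bounded_memory L m' \<and> I N m'"
        using exec.WhileTrue[OF st(1) 1(1) 2(1)] 2(3,4) by blast
    qed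
  qed
  from this[of N m] show ?thesis using assms(1) by simp
qed

section \<open>Counting loops and frame conditions\<close>

abbreviation var :: "nat \<Rightarrow> expr" where "var i \<equiv> Load 0 (Num i)"

abbreviation assign :: "nat \<Rightarrow> expr \<Rightarrow> prog" where "assign i e \<equiv> Store 0 (Num i) e"

text \<open>Truncated subtraction makes the test \<open>i < e\<close>. The bound \<open>e\<close> is
  evaluated afresh in each round, which is why the rule below asks for its value under the
  invariant.\<close>

definition for_loop :: "nat \<Rightarrow> expr \<Rightarrow> prog \<Rightarrow> prog" where
  "for_loop i e p = Seq (assign i (Num 0))
     (While (Sub e (var i)) (Seq p (assign i (Add (var i) (Num 1)))))"

lemma runs_for_loop:
  assumes "I 0 (m(0 := (m 0)(i := 0)))"
    and body: "\<And>k m. k < N \<Longrightarrow> I k m \<Longrightarrow> m 0 i = k \<Longrightarrow>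
      runs L p m s (\<lambda>m'. m' 0 i = k \<and> I (Suc k) (m'(0 := (m' 0)(i := Suc k))))"
    and bound: "\<And>k m. k \<le> N \<Longrightarrow> I k m \<Longrightarrow> m 0 i = k \<Longrightarrow> eval_expr e m = N"
    and "N < 2 ^ L" "\<And>m. I N m \<Longrightarrow> m 0 i = N \<Longrightarrow> Q m" "N * (s + 1) \<le> s'"
  shows "runs L (for_loop i e p) m s' Q"
  unfolding for_loop_def
proof (rule runs_Store_Seq)
  let ?m = "m(0 := (m 0)(eval_expr (Num i) m := eval_expr (Num 0) m))"
  have "runs L (While (Sub e (var i)) (Seq p (assign i (Add (var i) (Num 1))))) ?m (N * (s + 1))
      (\<lambda>m. I N m \<and> m 0 i = N)"
  proof (rule runs_While[where I = "\<lambda>k m. I k m \<and> m 0 i = k"], goal_cases)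
    case (2 k m)
    have "runs L (Seq p (assign i (Add (var i) (Num 1)))) m s (\<lambda>m. I (Suc k) m \<and> m 0 i = Suc k)"
      by (rule runs_Seq[OF body, where s\<^sub>2 = 0]) (use 2 assms(4) in \<open>auto intro!: runs_Store\<close>)
    then show ?case using 2 bound[of k m] by simp
  next
    case (3 m)
    then show ?case using bound[of N m] by simp
  qed (use assms(1) in simp)
  then show "runs L (While (Sub e (var i)) (Seq p (assign i (Add (var i) (Num 1))))) ?m s' Q"
    by (rule runs_mono) (use assms(5,6) in auto)
qed simp

text \<open>A frame condition: \<open>R\<close> lists single cells of bank 0, which holds the
  program variables, whereas \<open>B\<close> lists whole other banks.\<close>

definition unchanged :: "nat set \<Rightarrow> nat set \<Rightarrow> memory \<Rightarrow> memory \<Rightarrow> bool" where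
  "unchanged R B m m' \<longleftrightarrow> (\<forall>a. a \<notin> R \<longrightarrow> m' 0 a = m 0 a) \<and> (\<forall>b. b \<noteq> 0 \<longrightarrow> b \<notin> B \<longrightarrow> m' b = m b)"

section \<open>Testing domination\<close>

lemma unchangedD:
  assumes "unchanged R B m m'"
  shows "a \<notin> R \<Longrightarrow> m' 0 a = m 0 a" "b \<noteq> 0 \<Longrightarrow> b \<notin> B \<Longrightarrow> m' b = m b"
  using assms by (auto simp: unchanged_def)

lemma unchanged_refl [simp]: "unchanged R B m m"
  by (simp add: unchanged_def)

lemma unchanged_trans:
  "unchanged R B m m' \<Longrightarrow> unchanged R' B' m' m'' \<Longrightarrow> R \<union> R' \<subseteq> R'' \<Longrightarrow> B \<union> B' \<subseteq> B'' \<Longrightarrow>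
    unchanged R'' B'' m m''"
  unfolding unchanged_def by (metis UnCI subsetD)

section \<open>Vertex sets as bit masks\<close>

lemma set_encode_div_mod: "finite Y \<Longrightarrow> set_encode Y div 2 ^ i mod 2 = of_bool (i \<in> Y)"
proof -
  assume "finite Y"
  then have "i \<in> Y \<longleftrightarrow> i \<in> set_decode (set_encode Y)" by simp
  also have "\<dots> \<longleftrightarrow> odd (set_encode Y div 2 ^ i)" by (simp add: set_decode_def)
  finally show ?thesis by (simp add: mod2_eq_if)
qed

lemma set_encode_lessThan: "set_encode {..<n} = 2 ^ n - 1"
  unfolding set_encode_def by (induction n) simp_all

lemma set_encode_less:
  assumes "X \<subseteq> {..<n}"
  shows "set_encode X < 2 ^ n"
proof -
  have "set_encode X \<le> set_encode {..<n}" unfolding set_encode_def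
    using assms by (intro sum_mono2) auto
  moreover have "(0::nat) < 2 ^ n" by simp
  ultimately show ?thesis unfolding set_encode_lessThan by linarith
qed

text \<open>
  Sets of vertices are stored as \<open>set_encode\<close> masks. Bank 3 is a queue of masks, whose current part
  begins at cell 4 of bank 0 and ends before cell 5; banks 4 and 5 are indexed by masks and hold the
  weights \<open>Z ^ card X\<close> and the table that is transformed; bank 6 holds the powers of two. In bank 0,
  cells 1, 15 and 16 are \<open>k\<close>, \<open>Z\<close> and \<open>2 ^ n\<close>, cell 7 is the mask being processed, cell 8 the argument
  of the domination test and cell 9 its result.
\<close>

definition bit_expr :: "expr \<Rightarrow> expr \<Rightarrow> expr" where
  "bit_expr x i = Sub (Div x (Load 6 i)) (Mul (Num 2) (Div (Div x (Load 6 i)) (Num 2)))"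

lemma eval_bit_expr [simp]:
  "eval_expr (bit_expr x i) m = eval_expr x m div m 6 (eval_expr i m) mod 2"
  by (simp add: bit_expr_def minus_mult_div_eq_mod)

definition graph_memory :: "nat \<Rightarrow> nat set set \<Rightarrow> memory \<Rightarrow> bool" where
  "graph_memory n E m \<longleftrightarrow> m 0 0 = n \<and> (\<forall>i<n. \<forall>j<n. m 1 (i * n + j) = of_bool ({i, j} \<in> E)) \<and>
     (\<forall>i\<le>n. m 6 i = 2 ^ i)"

lemma graph_memory_unchanged:
  "graph_memory n E m \<Longrightarrow> unchanged R B m m' \<Longrightarrow> 0 \<notin> R \<Longrightarrow> 1 \<notin> B \<Longrightarrow> 6 \<notin> B \<Longrightarrow> graph_memory n E m'"
  by (simp add: graph_memory_def unchanged_def)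

text \<open>Cell 10 is the vertex and cell 12 scans its row. Cell 14 starts with the vertex's own
  bit and so counts the members of its closed neighbourhood in the set. A row can only clear cell 9,
  so over all rows this cell becomes a conjunction.\<close>

definition dom_row :: prog where
  "dom_row = Seq (assign 14 (bit_expr (var 8) (var 10))) (Seq (for_loop 12 (var 0)
     (assign 14 (Add (var 14)
       (Mul (Load 1 (Add (Mul (var 10) (var 0)) (var 12))) (bit_expr (var 8) (var 12))))))
     (If (var 14) Skip (assign 9 (Num 0))))"

definition dom_test :: prog where
  "dom_test = Seq (assign 9 (Num 1)) (for_loop 10 (var 0) dom_row)"

lemma power_bounds:
  assumes "n + 2 \<le> L"
  shows "n + 2 < 2 ^ L" "i \<le> n + 1 \<Longrightarrow> (2::nat) ^ i < 2 ^ L"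
proof -
  have "n + 2 < 2 ^ (n + 2)" by (rule less_exp)
  also have "\<dots> \<le> (2::nat) ^ L" using assms by (intro power_increasing) auto
  finally show "n + 2 < 2 ^ L" .
  show "i \<le> n + 1 \<Longrightarrow> (2::nat) ^ i < 2 ^ L" using assms by (intro power_strict_increasing) auto
qed

lemma runs_dom_row:
  assumes m: "graph_memory n E m" "m 0 8 = set_encode Y" "Y \<subseteq> {..<n}" "m 0 10 = v" "v < n"
    and L: "n + 2 \<le> L"
  shows "runs L dom_row m n (\<lambda>m'. unchanged {9,12,14} {} m m' \<and>
    m' 0 9 = (if closed_nbh E v \<inter> Y = {} then 0 else m 0 9))"
proof -
  note B = power_bounds[OF L]
  have finY: "finite Y" using m(3) finite_subset by blast
  define c where "c u = (of_bool (v \<in> Y) + (\<Sum>w<u. of_bool ({v, w} \<in> E \<and> w \<in> Y)) :: nat)" for u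
  have c_le: "c u \<le> u + 1" for u
    unfolding c_def by (induction u) (auto simp: of_bool_def)
  define I where "I u m' \<longleftrightarrow> unchanged {12,14} {} m m' \<and> m' 0 14 = c u" for u m'
  have cn: "c n = 0 \<longleftrightarrow> closed_nbh E v \<inter> Y = {}"
    using m(3) by (auto simp: c_def closed_nbh_def neighbours_def insert_commute)
  have "1 < (2::nat) ^ L" using B(1) by linarith
  then have bit: "set_encode Y div 2 ^ i mod 2 < 2 ^ L" for i
    using finY by (simp add: set_encode_div_mod)
  show ?thesis
    unfolding dom_row_def
  proof (intro runs_Store_Seq, goal_cases)
    case 1
    show ?case using m bit by (simp add: graph_memory_def)
  next
    case 2
    show ?case
    proof (rule runs_Seq[where R = "I n" and s\<^sub>1 = n and s\<^sub>2 = 0], goal_cases)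
      case 1
      show ?case
      proof (rule runs_for_loop[where I = I and N = n and s = 0], goal_cases)
        case 1
        show ?case using m finY
          by (simp add: I_def c_def unchanged_def graph_memory_def set_encode_div_mod)
      next
        case (2 u m')
        then have *: "m' 0 0 = n" "m' 0 10 = v" "m' 0 8 = set_encode Y" "m' 6 u = 2 ^ u"
          "m' 1 (v * n + u) = of_bool ({v, u} \<in> E)" "m' 0 14 = c u" "m' 0 12 = u"
          using m by (auto simp: I_def unchanged_def graph_memory_def)
        show ?case
          using * 2 finY c_le[of "Suc u"] B(1)
          by (intro runs_Store) (auto simp: set_encode_div_mod I_def c_def unchanged_def)
      next
        case (3 u m')
        then show ?case using m by (auto simp: I_def unchanged_def graph_memory_def)
      qed (use B in auto)
    next
      case (2 m')
      then show ?case using cn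
        by (intro runs_If runs_Skip runs_Store) (auto simp: I_def unchanged_def)
    qed simp
  qed
qed

lemma runs_dom_test:
  assumes m: "graph_memory n E m" "m 0 8 = set_encode Y" "Y \<subseteq> {..<n}" and L: "n + 2 \<le> L"
  shows "runs L dom_test m (n * (n + 1)) (\<lambda>m'. unchanged {9,10,12,14} {} m m' \<and>
    m' 0 9 = of_bool (dominating_set {..<n} E Y))"
proof -
  note B = power_bounds[OF L]
  define I where "I v m' \<longleftrightarrow> unchanged {9,10,12,14} {} m m' \<and>
    m' 0 9 = of_bool (\<forall>w<v. closed_nbh E w \<inter> Y \<noteq> {})" for v m'
  show ?thesis
    unfolding dom_test_def
  proof (intro runs_Store_Seq, goal_cases)
    case 2
    show ?case
    proof (rule runs_for_loop[where I = I and N = n and s = n], goal_cases)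
      case 1
      show ?case by (simp add: I_def unchanged_def)
    next
      case (2 v m')
      show ?case
      proof (rule runs_mono[OF runs_dom_row[where n = n and E = E and Y = Y and v = v]], goal_cases)
        case 1
        show ?case by (rule graph_memory_unchanged[OF m(1)]) (use 2 in \<open>auto simp: I_def\<close>)
      next
        case (7 m'')
        then show ?case using 2 by (auto simp: I_def unchanged_def less_Suc_eq)
      qed (use 2 m L in \<open>auto simp: I_def unchanged_def\<close>)
    next
      case (5 m')
      then show ?case using m(3) by (auto simp: I_def dominating_set_iff)
    qed (use B m in \<open>auto simp: I_def unchanged_def graph_memory_def\<close>)
  qed (use B in auto)
qed

section \<open>Enumerating the balanced sets\<close>

definition extensions :: "nat \<Rightarrow> nat set set \<Rightarrow> nat \<Rightarrow> nat set \<Rightarrow> nat set list" where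
  "extensions n E i X = filter (\<lambda>Y. Y \<in> prefix_family n E (Suc i)) [X, insert i X]"

fun level :: "nat \<Rightarrow> nat set set \<Rightarrow> nat \<Rightarrow> nat set list" where
  "level n E 0 = [{}]"
| "level n E (Suc i) = concat (map (extensions n E i) (level n E i))"

definition levels_below :: "nat \<Rightarrow> nat set set \<Rightarrow> nat \<Rightarrow> nat set list" where
  "levels_below n E i = concat (map (level n E) [0..<i])"

lemma levels_below_Suc: "levels_below n E (Suc i) = levels_below n E i @ level n E i"
  by (simp add: levels_below_def)

text \<open>Undeciding \<open>i\<close> puts it back on both sides, so neither can lose domination.
  Hence every balanced prefix extends a shorter one and the search by levels misses nothing.\<close>

lemma prefix_family_Suc:
  assumes "i < n" "Y \<in> prefix_family n E (Suc i)"
  shows "Y - {i} \<in> prefix_family n E i"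
proof -
  have "dominating_set {..<n} E (Y - {i} \<union> {i..<n})"
    by (rule dominating_set_mono[of _ _ "Y \<union> {Suc i..<n}"]) (use assms in \<open>auto simp: prefix_family_def\<close>)
  moreover have "dominating_set {..<n} E ({..<n} - (Y - {i}))"
    by (rule dominating_set_mono[of _ _ "{..<n} - Y"]) (use assms in \<open>auto simp: prefix_family_def\<close>)
  moreover have "Y - {i} \<subseteq> {..<i}" using assms(2) by (auto simp: prefix_family_def)
  ultimately show ?thesis by (simp add: prefix_family_def)
qed

lemma prefix_family_0: "prefix_family n E 0 = {{}}"
  by (auto simp: prefix_family_def dominating_set_def)

lemma distinct_concat_map:
  assumes "distinct xs" "\<And>x. x \<in> set xs \<Longrightarrow> distinct (f x)"
    "\<And>x y. x \<in> set xs \<Longrightarrow> y \<in> set xs \<Longrightarrow> x \<noteq> y \<Longrightarrow> set (f x) \<inter> set (f y) = {}"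
  shows "distinct (concat (map f xs))"
  using assms
proof (induction xs)
  case (Cons x xs)
  then show ?case by (auto simp: disjoint_iff)
qed simp

text \<open>Completeness is the previous observation about undeciding \<open>i\<close>. No set is
  produced twice because \<open>Y - {i}\<close> recovers the prefix from which \<open>Y\<close> was
  obtained.\<close>

lemma level_prefix_family:
  "i \<le> n \<Longrightarrow> distinct (level n E i) \<and> set (level n E i) = prefix_family n E i"
proof (induction i)
  case 0
  then show ?case by (simp add: prefix_family_0)
next
  case (Suc i)
  then have IH: "distinct (level n E i)" "set (level n E i) = prefix_family n E i" by auto
  have sub: "X \<subseteq> {..<i}" if "X \<in> prefix_family n E i" for X
    using that by (auto simp: prefix_family_def)
  have "set (level n E (Suc i)) = prefix_family n E (Suc i)"
  proof
    show "prefix_family n E (Suc i) \<subseteq> set (level n E (Suc i))"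
    proof
      fix Y assume Y: "Y \<in> prefix_family n E (Suc i)"
      then have "Y - {i} \<in> prefix_family n E i" using prefix_family_Suc Suc.prems by simp
      moreover have "Y \<in> set [Y - {i}, insert i (Y - {i})]" by auto
      then have "Y \<in> set (extensions n E i (Y - {i}))"
        using Y unfolding extensions_def set_filter by blast
      ultimately show "Y \<in> set (level n E (Suc i))"
        unfolding level.simps set_concat set_map IH(2) by blast
    qed
  qed (auto simp: extensions_def split: if_splits)
  moreover have "distinct (level n E (Suc i))"
    unfolding level.simps
  proof (rule distinct_concat_map[OF IH(1)], unfold IH(2))
    have diff: "Y - {i} = X" if "X \<in> prefix_family n E i" "Y \<in> set (extensions n E i X)" for X Y
      using sub[OF that(1)] that(2) by (auto simp: extensions_def split: if_splits)
    fix X assume X: "X \<in> prefix_family n E i"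
    then show "distinct (extensions n E i X)" using sub[OF X] by (auto simp: extensions_def)
    fix X' assume "X' \<in> prefix_family n E i" "X \<noteq> X'"
    then show "set (extensions n E i X) \<inter> set (extensions n E i X') = {}"
      using diff X by (metis disjoint_iff)
  qed
  ultimately show ?case by blast
qed

lemma length_level:
  assumes "i \<le> n"
  shows "length (level n E i) = card (prefix_family n E i)" "length (level n E i) \<le> 2 ^ i"
proof -
  show *: "length (level n E i) = card (prefix_family n E i)"
    using level_prefix_family[OF assms] distinct_card by metis
  have "card (prefix_family n E i) \<le> card (Pow {..<i})"
    by (intro card_mono) (auto simp: prefix_family_def)
  then show "length (level n E i) \<le> 2 ^ i" by (simp add: * card_Pow)
qed

lemma length_levels_below: "i \<le> n \<Longrightarrow> length (levels_below n E i) < 2 ^ i"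
proof (induction i)
  case (Suc i)
  then show ?case using length_level(2)[of i n E] by (simp add: levels_below_Suc)
qed (simp add: levels_below_def)

lemma set_encode_Un: "finite A \<Longrightarrow> finite B \<Longrightarrow> A \<inter> B = {} \<Longrightarrow> set_encode (A \<union> B) = set_encode A + set_encode B"
  unfolding set_encode_def by (rule sum.union_disjoint)

lemma set_encode_complement:
  assumes "X \<subseteq> {..<n}"
  shows "set_encode ({..<n} - X) = 2 ^ n - 1 - set_encode X"
proof -
  have "finite X" using assms finite_subset by blast
  moreover have "X \<union> ({..<n} - X) = {..<n}" using assms by auto
  ultimately show ?thesis
    using set_encode_Un[of X "{..<n} - X"] set_encode_lessThan[of n] by auto
qed

lemma set_encode_Un_tail:
  assumes "X \<subseteq> {..<i}" "i \<le> n"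
  shows "set_encode (X \<union> {i..<n}) = set_encode X + 2 ^ n - 2 ^ i"
proof -
  have "set_encode ({..<i} \<union> {i..<n}) = set_encode {..<i} + set_encode {i..<n}"
    by (rule set_encode_Un) auto
  moreover have "{..<i} \<union> {i..<n} = {..<n}" using assms by auto
  ultimately have "2 ^ n - 1 = 2 ^ i - 1 + set_encode {i..<n}"
    by (simp only: set_encode_lessThan)
  moreover have "0 < (2::nat) ^ i" "0 < (2::nat) ^ n" by simp_all
  ultimately have "set_encode {i..<n} + 2 ^ i = 2 ^ n" by linarith
  moreover have "set_encode (X \<union> {i..<n}) = set_encode X + set_encode {i..<n}"
    using assms finite_subset by (intro set_encode_Un) auto
  ultimately show ?thesis by simp
qed

section \<open>The queue of masks\<close>

definition queue :: "memory \<Rightarrow> nat list" where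
  "queue m = map (m 3) [0..<m 0 5]"

lemma queue_eqD:
  assumes "queue m = xs"
  shows "m 0 5 = length xs" "j < length xs \<Longrightarrow> m 3 j = xs ! j"
  using assms by (auto simp: queue_def)

text \<open>Both arguments of the domination test are formed by arithmetic on masks:
  \<open>2 ^ n - 2 ^ (i + 1)\<close> adds all undecided vertices, and subtraction from
  \<open>2 ^ n - 1\<close> is the complement. In the first, the addition comes before the
  subtraction, so nothing is truncated.\<close>

definition try_extension :: prog where
  "try_extension = Seq (assign 8 (Sub (Add (var 7) (var 16)) (Load 6 (Add (var 2) (Num 1)))))
    (Seq dom_test (If (var 9)
      (Seq (assign 8 (Sub (Sub (var 16) (Num 1)) (var 7)))
        (Seq dom_test (If (var 9)
          (Seq (Store 3 (var 5) (var 7)) (assign 5 (Add (var 5) (Num 1))))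
          Skip)))
      Skip))"

lemma runs_try_extension:
  assumes m: "graph_memory n E m" "m 0 16 = 2 ^ n" "m 0 2 = i" "i < n"
    "m 0 7 = set_encode X" "X \<subseteq> {..<Suc i}" "m 0 5 + 1 < 2 ^ L" and L: "n + 2 \<le> L"
  shows "runs L try_extension m (2 * (n * (n + 1))) (\<lambda>m'. unchanged {5,8,9,10,12,14} {3} m m' \<and>
    queue m' = queue m @ (if X \<in> prefix_family n E (Suc i) then [set_encode X] else []))"
proof -
  note B = power_bounds[OF L]
  let ?d = "n * (n + 1)"
  have "X \<subseteq> {..<n}" using m by auto
  have enc: "set_encode Y < 2 ^ L" if "Y \<subseteq> {..<n}" for Y
    by (rule less_trans[OF set_encode_less[OF that]]) (use B(2)[of n] in simp)
  have lev: "m 6 (Suc i) = 2 ^ Suc i" using m by (simp add: graph_memory_def)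
  have A1: "set_encode X + 2 ^ n - 2 ^ Suc i = set_encode (X \<union> {Suc i..<n})"
    using m by (intro set_encode_Un_tail[symmetric]) auto
  have A2: "2 ^ n - 1 - set_encode X = set_encode ({..<n} - X)"
    using set_encode_complement[OF \<open>X \<subseteq> {..<n}\<close>] by simp
  have sub: "X \<union> {Suc i..<n} \<subseteq> {..<n}" "{..<n} - X \<subseteq> {..<n}" using \<open>X \<subseteq> {..<n}\<close> by auto
  define P where "P D m' \<longleftrightarrow> unchanged {8,9,10,12,14} {} m m' \<and> m' 0 9 = of_bool (dominating_set {..<n} E D)"
    for D m'
  have test: "runs L dom_test m' ?d (P D)" if "unchanged {8,9,10,12,14} {} m m'" "m' 0 8 = set_encode D" "D \<subseteq> {..<n}"
    for m' D
  proof (rule runs_mono[OF runs_dom_test[where n = n and E = E and Y = D]], goal_cases)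
    case 1
    show ?case by (rule graph_memory_unchanged[OF m(1) that(1)]) auto
  next
    case (5 m'')
    then show ?case using that unfolding P_def by (auto intro: unchanged_trans)
  qed (use that L in auto)
  have reg: "m' 0 16 = 2 ^ n" "m' 0 7 = set_encode X" "m' 0 5 = m 0 5" "m' 3 = m 3"
    if "unchanged {8,9,10,12,14} {} m m'" for m'
    using unchangedD[OF that] m by auto
  have fam: "X \<in> prefix_family n E (Suc i) \<longleftrightarrow>
      dominating_set {..<n} E (X \<union> {Suc i..<n}) \<and> dominating_set {..<n} E ({..<n} - X)"
    using m by (simp add: prefix_family_def)
  show ?thesis
    unfolding try_extension_def
  proof (intro runs_Store_Seq, goal_cases)
    case 1
    show ?case using m lev A1 enc[OF sub(1)] by simp
  next
    case 2
    show ?case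
    proof (rule runs_Seq[OF test, where s\<^sub>2 = ?d])
      fix m1 assume m1: "P (X \<union> {Suc i..<n}) m1"
      show "runs L (If (var 9) (Seq (assign 8 (Sub (Sub (var 16) (Num 1)) (var 7)))
        (Seq dom_test (If (var 9) (Seq (Store 3 (var 5) (var 7)) (assign 5 (Add (var 5) (Num 1)))) Skip))) Skip)
        m1 ?d (\<lambda>m'. unchanged {5,8,9,10,12,14} {3} m m' \<and>
          queue m' = queue m @ (if X \<in> prefix_family n E (Suc i) then [set_encode X] else []))"
      proof (rule runs_If, goal_cases)
        case 1
        then have d1: "dominating_set {..<n} E (X \<union> {Suc i..<n})" using m1 by (simp add: P_def)
        show ?case
        proof (intro runs_Store_Seq, goal_cases)
          case 1
          show ?case using m1 reg[of m1] A2 enc[OF sub(2)] by (simp add: P_def)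
        next
          case 2
          show ?case
          proof (rule runs_Seq[OF test, where s\<^sub>2 = 0])
            fix m2 assume m2: "P ({..<n} - X) m2"
            then have u: "unchanged {8,9,10,12,14} {} m m2" by (simp add: P_def)
            show "runs L (If (var 9) (Seq (Store 3 (var 5) (var 7)) (assign 5 (Add (var 5) (Num 1)))) Skip)
              m2 0 (\<lambda>m'. unchanged {5,8,9,10,12,14} {3} m m' \<and>
              queue m' = queue m @ (if X \<in> prefix_family n E (Suc i) then [set_encode X] else []))"
              using m2 u reg[OF u] m(7) enc[OF \<open>X \<subseteq> {..<n}\<close>] d1
              by (intro runs_If runs_Store_Seq runs_Store runs_Skip)
                (auto simp: P_def fam queue_def unchanged_def)
          qed (use m1 A2 sub reg[of m1] in \<open>auto simp: P_def unchanged_def\<close>)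
        qed
      next
        case 2
        then show ?case using m1 reg[of m1]
          by (intro runs_Skip) (auto simp: P_def fam queue_def unchanged_def)
      qed
    qed (use m lev A1 sub in \<open>auto simp: unchanged_def\<close>)
  qed
qed

text \<open>The weight of the set enlarged by \<open>i\<close> is derived from that of its parent
  and written even if the set is then rejected. The parent's mask and weight carry over when
  \<open>i\<close> is left out.\<close>

definition extend_entry :: prog where
  "extend_entry = Seq (assign 7 (Load 3 (Add (var 4) (var 17))))
    (Seq (Store 4 (Add (var 7) (Load 6 (var 2))) (Mul (Load 4 (var 7)) (var 15)))
    (Seq try_extension
    (Seq (assign 7 (Add (var 7) (Load 6 (var 2)))) try_extension)))"

text \<open>Cell 6 freezes the length of the level, since cell 5 moves as extensions are
  appended.\<close>

definition extend_level :: prog where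
  "extend_level = Seq (assign 6 (Sub (var 5) (var 4))) (Seq (for_loop 17 (var 6) extend_entry)
    (assign 4 (Add (var 4) (var 6))))"

text \<open>Cell 0 of bank 3 is presupposed to be 0, the mask of the empty set, so setting cell 5 to
  1 already enqueues it.\<close>

definition enumerate :: prog where
  "enumerate = Seq (Store 4 (Num 0) (Num 1)) (Seq (assign 4 (Num 0)) (Seq (assign 5 (Num 1))
    (for_loop 2 (var 0) extend_level)))"

definition weights :: "nat \<Rightarrow> nat set set \<Rightarrow> memory \<Rightarrow> bool" where
  "weights Z F m \<longleftrightarrow> (\<forall>X\<in>F. m 4 (set_encode X) = Z ^ card X)"

lemma runs_extend_level:
  assumes m: "graph_memory n E m" "m 0 16 = 2 ^ n" "m 0 15 = Z" "m 0 2 = i" "i < n"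
    "queue m = map set_encode (levels_below n E (Suc i))" "m 0 4 = length (levels_below n E i)"
    "weights Z (prefix_family n E i) m"
    and L: "n + 2 \<le> L" "Z ^ n < 2 ^ L" "Z > 0" and b: "card (prefix_family n E i) \<le> b"
  shows "runs L extend_level m (b * (4 * (n * (n + 1)) + 1)) (\<lambda>m'.
    unchanged {4,5,6,7,8,9,10,12,14,17} {3,4} m m' \<and>
    queue m' = map set_encode (levels_below n E (Suc (Suc i))) \<and>
    m' 0 4 = length (levels_below n E (Suc i)) \<and> weights Z (prefix_family n E (Suc i)) m')"
proof -
  note B = power_bounds[OF L(1)]
  define lev where "lev = level n E i"
  define pre where "pre = levels_below n E i"
  have lev: "distinct lev" "set lev = prefix_family n E i" "length lev \<le> 2 ^ i" "length lev \<le> b"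
    using level_prefix_family[of i n E] length_level[of i n E] b m(5) by (auto simp: lev_def)
  have sub: "X \<subseteq> {..<i}" if "X \<in> set lev" for X
    using that lev(2) by (auto simp: prefix_family_def)
  have fin: "finite X" if "X \<in> set lev" for X using sub[OF that] finite_subset by blast
  have pre: "length pre < 2 ^ i" unfolding pre_def using m(5) by (intro length_levels_below) simp
  define ext where "ext j = concat (map (extensions n E i) (take j lev))" for j
  have ext_Suc: "ext (Suc j) = ext j @ extensions n E i (lev ! j)" if "j < length lev" for j
    using that by (simp add: ext_def take_Suc_conv_app_nth)
  have len_ext: "length (ext j) \<le> 2 * j" if "j \<le> length lev" for j
    using that
  proof (induction j)
    case (Suc j)
    have "length (extensions n E i X) \<le> 2" for X by (simp add: extensions_def)
    from this[of "lev ! j"] show ?case using Suc ext_Suc[of j] by simp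
  qed (simp add: ext_def)
  \<comment> \<open>There are fewer than \<open>2 ^ i\<close> entries of earlier levels, at most
    \<open>2 ^ i\<close> of the current one and at most twice as many extensions. This total of
    \<open>4 * 2 ^ i\<close> keeps the queue addresses below \<open>2 ^ L\<close>.\<close>
  have pw: "(2::nat) ^ i * 4 \<le> 2 ^ (n + 1)" using m(5) power_increasing[of "i + 2" "n + 1" "2::nat"]
    by (simp add: power_add)
  have size: "length pre + length lev + length (ext j) + 2 < 2 ^ L" if "j < length lev" for j
    using len_ext[of j] that lev(3) pre pw B(2)[of "n + 1", OF order_refl] by linarith
  define J where "J j m' \<longleftrightarrow> unchanged {5,6,7,8,9,10,12,14,17} {3,4} m m' \<and> m' 0 6 = length lev \<and>
    queue m' = map set_encode (pre @ lev @ ext j) \<and>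
    weights Z (set lev \<union> insert i ` set (take j lev)) m'" for j m'
  have T: "m 0 5 = length pre + length lev" "queue m = map set_encode (pre @ lev)"
    using queue_eqD(1)[OF m(6)] m(6) by (simp_all add: levels_below_Suc pre_def lev_def)
  have lenL: "length lev < 2 ^ L" "length pre + length lev < 2 ^ L" using lev(3) pre pw B(2)[of "n + 1", OF order_refl] by linarith+
  have body: "runs L extend_entry m1 (4 * (n * (n + 1)))
      (\<lambda>m'. m' 0 17 = j \<and> J (Suc j) (m'(0 := (m' 0)(17 := Suc j))))"
    if j: "j < length lev" "J j m1" "m1 0 17 = j" for j m1
  proof -
    define X where "X = lev ! j"
    have X: "X \<in> set lev" "X \<subseteq> {..<i}" "finite X" "i \<notin> X" "X \<subseteq> {..<Suc i}" "insert i X \<subseteq> {..<Suc i}"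
      using j sub[of X] fin[of X] by (auto simp: X_def)
    have cX: "card X < n" using card_mono[OF _ X(2)] m(5) by simp
    have encX: "set_encode (insert i X) = set_encode X + 2 ^ i" using X by simp
    have u: "unchanged {5,6,7,8,9,10,12,14,17} {3,4} m m1" using j(2) by (simp add: J_def)
    have q: "queue m1 = map set_encode (pre @ lev @ ext j)" using j(2) by (simp add: J_def)
    have r: "m1 0 4 = length pre" "m1 0 2 = i" "m1 0 15 = Z" "m1 0 16 = 2 ^ n" "m1 6 i = 2 ^ i"
      "m1 0 5 = length pre + length lev + length (ext j)" "m1 3 (length pre + j) = set_encode X"
      using unchangedD[OF u] m queue_eqD[OF q] j(1)
      by (auto simp: pre_def graph_memory_def X_def nth_append)
    have wX: "m1 4 (set_encode X) = Z ^ card X" using j(2) X(1) by (auto simp: J_def weights_def)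
    have "Z ^ card X * Z \<le> Z ^ n"
      using cX L(3) power_increasing[of "Suc (card X)" n Z] by (simp add: mult.commute)
    then have wb: "Z ^ card X * Z < 2 ^ L" using L(2) by linarith
    have eb: "set_encode X < 2 ^ L" "set_encode (insert i X) < 2 ^ L"
      using set_encode_less[OF X(5)] set_encode_less[OF X(6)] B(2)[of "Suc i"] m(5)
      by (metis (no_types) Suc_eq_plus1 Suc_leI le_SucI less_trans)+
    define m2 where "m2 = m1(0 := (m1 0)(7 := set_encode X), 4 := (m1 4)(set_encode (insert i X) := Z ^ card X * Z))"
    have u2: "unchanged {5,6,7,8,9,10,12,14,17} {3,4} m m2" using u by (auto simp: m2_def unchanged_def)
    have w2: "weights Z (set lev \<union> insert i ` set (take (Suc j) lev)) m2"
      unfolding weights_def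
    proof
      fix Y assume Y: "Y \<in> set lev \<union> insert i ` set (take (Suc j) lev)"
      then have "finite Y" using fin by (auto dest: in_set_takeD)
      show "m2 4 (set_encode Y) = Z ^ card Y"
      proof (cases "Y = insert i X")
        case True
        then show ?thesis using X by (simp add: m2_def)
      next
        case False
        then have "set_encode Y \<noteq> set_encode (insert i X)"
          using \<open>finite Y\<close> X(3) by (simp add: set_encode_eq del: set_encode_insert)
        moreover have "Y \<in> set lev \<union> insert i ` set (take j lev)"
          using Y False j(1) by (auto simp: take_Suc_conv_app_nth X_def)
        ultimately show ?thesis using j(2) by (auto simp: m2_def J_def weights_def simp del: set_encode_insert)
      qed
    qed
    \<comment> \<open>The state around the two attempts for one entry: \<open>Y\<close> is the mask
      currently in cell 7, \<open>ys\<close> the extensions accepted so far.\<close>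
    define R where "R Y ys m' \<longleftrightarrow> unchanged {5,7,8,9,10,12,14} {3} m2 m' \<and> m' 0 7 = set_encode Y \<and>
      queue m' = map set_encode (pre @ lev @ ext j @ ys)" for Y ys m'
    have attempt: "runs L try_extension m' (2 * (n * (n + 1)))
        (R Y (ys @ filter (\<lambda>Y. Y \<in> prefix_family n E (Suc i)) [Y]))"
      if "R Y ys m'" "length ys \<le> 1" "Y \<subseteq> {..<Suc i}" for Y ys m'
    proof -
      have u': "unchanged {5,7,8,9,10,12,14} {3} m2 m'" using that by (simp add: R_def)
      have u'': "unchanged {5,6,7,8,9,10,12,14,17} {3,4} m m'" using u2 u' by (rule unchanged_trans) auto
      have "m' 0 5 = length pre + length lev + length (ext j) + length ys"
        using queue_eqD(1)[of m'] that(1) by (simp add: R_def)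
      then have "m' 0 5 + 1 < 2 ^ L" using size[OF j(1)] that(2) by linarith
      then have "runs L try_extension m' (2 * (n * (n + 1))) (\<lambda>m''. unchanged {5,8,9,10,12,14} {3} m' m'' \<and>
        queue m'' = queue m' @ (if Y \<in> prefix_family n E (Suc i) then [set_encode Y] else []))"
        using that u'' m L
        by (intro runs_try_extension graph_memory_unchanged[OF m(1) u'']) (auto simp: R_def unchanged_def)
      then show ?thesis
      proof (rule runs_mono)
        fix m'' assume *: "unchanged {5,8,9,10,12,14} {3} m' m'' \<and>
          queue m'' = queue m' @ (if Y \<in> prefix_family n E (Suc i) then [set_encode Y] else [])"
        then have "unchanged {5,7,8,9,10,12,14} {3} m2 m''"
          using u' by (auto intro: unchanged_trans)
        moreover have "m'' 0 7 = set_encode Y" using * that(1) by (auto simp: R_def unchanged_def)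
        ultimately show "R Y (ys @ filter (\<lambda>Y. Y \<in> prefix_family n E (Suc i)) [Y]) m''"
          using * that(1) by (simp add: R_def)
      qed simp
    qed
    have "runs L (Seq try_extension (Seq (assign 7 (Add (var 7) (Load 6 (var 2)))) try_extension)) m2
        (4 * (n * (n + 1))) (\<lambda>m'. m' 0 17 = j \<and> J (Suc j) (m'(0 := (m' 0)(17 := Suc j))))"
    proof (rule runs_Seq[OF attempt[where Y = X and ys = "[]"], where s\<^sub>2 = "2 * (n * (n + 1))"], goal_cases)
      case 1
      show ?case using q by (simp add: R_def m2_def queue_def)
    next
      case (4 m3)
      define ys where "ys = filter (\<lambda>Y. Y \<in> prefix_family n E (Suc i)) [X]"
      have m3: "R X ys m3" using 4 by (simp add: ys_def)
      have ys: "length ys \<le> 1" by (simp add: ys_def)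
      have u3: "unchanged {5,6,7,8,9,10,12,14,17} {3,4} m m3"
        by (rule unchanged_trans[OF u2, of "{5,7,8,9,10,12,14}" "{3}"]) (use m3 in \<open>auto simp: R_def\<close>)
      have r3: "m3 0 7 = set_encode X" "m3 0 2 = i" "m3 6 i = 2 ^ i"
        using m3 unchangedD[OF u3] m by (auto simp: R_def graph_memory_def)
      have finish: "J (Suc j) (m4(0 := (m4 0)(17 := Suc j))) \<and> m4 0 17 = j"
        if "R (insert i X) (ys @ filter (\<lambda>Y. Y \<in> prefix_family n E (Suc i)) [insert i X]) m4" for m4
      proof -
        have u4: "unchanged {5,7,8,9,10,12,14} {3} m2 m4" using that by (simp add: R_def)
        have "m2 0 6 = length lev" "m2 0 17 = j" using j by (simp_all add: m2_def J_def)
        then have "m4 0 6 = length lev" "m4 0 17 = j" using unchangedD[OF u4] by auto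
        moreover have "unchanged {5,6,7,8,9,10,12,14,17} {3,4} m m4"
          by (rule unchanged_trans[OF u2 u4]) auto
        moreover have "weights Z (set lev \<union> insert i ` set (take (Suc j) lev)) m4"
          using w2 unchangedD(2)[OF u4, of 4] by (simp add: weights_def)
        moreover have "queue m4 = map set_encode (pre @ lev @ ext (Suc j))"
          using that unfolding R_def ext_Suc[OF j(1)] by (simp add: ys_def extensions_def X_def)
        ultimately show ?thesis by (simp add: J_def unchanged_def weights_def queue_def)
      qed
      show ?case
      proof (intro runs_Store_Seq, goal_cases)
        case 1
        show ?case using r3 eb encX by simp
      next
        case 2
        show ?case
        proof (rule runs_mono[OF attempt[where Y = "insert i X" and ys = ys]], goal_cases)
          case 1
          show ?case using m3 r3 encX
            by (auto simp: R_def unchanged_def queue_def simp del: set_encode_insert)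
        qed (use ys X finish in auto)
      qed
    qed (use X in auto)
    then show ?thesis
      unfolding extend_entry_def using r j eb wX wb encX
      by (intro runs_Store_Seq) (simp_all add: m2_def del: set_encode_insert)
  qed
  show ?thesis
    unfolding extend_level_def
  proof (intro runs_Store_Seq, goal_cases)
    case 1
    show ?case using T lenL m by (simp add: pre_def)
  next
    case 2
    show ?case
    proof (rule runs_Seq[where R = "J (length lev)" and s\<^sub>2 = 0 and s\<^sub>1 = "b * (4 * (n * (n + 1)) + 1)"], goal_cases)
      case 1
      show ?case
      proof (rule runs_for_loop[where I = J and N = "length lev" and s = "4 * (n * (n + 1))"], goal_cases)
        case 1
        show ?case using T m lev(2)
          by (auto simp: J_def unchanged_def queue_def ext_def weights_def pre_def)
      next
        case (2 j m')
        then show ?case by (rule body)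
      next
        case (3 j m')
        then show ?case by (simp add: J_def)
      next
        case 6
        show ?case using lev(4) by (intro mult_le_mono1)
      qed (use lenL in auto)
    next
      case (2 m')
      have u: "unchanged {5,6,7,8,9,10,12,14,17} {3,4} m m'" using 2 by (simp add: J_def)
      have "m' 0 4 = length pre" using unchangedD(1)[OF u, of 4] m by (simp add: pre_def)
      moreover have "weights Z (prefix_family n E (Suc i)) m'"
      proof -
        have "prefix_family n E (Suc i) \<subseteq> set lev \<union> insert i ` set lev"
        proof
          fix Y assume Y: "Y \<in> prefix_family n E (Suc i)"
          then have "Y - {i} \<in> set lev" using prefix_family_Suc m(5) lev(2) by simp
          then show "Y \<in> set lev \<union> insert i ` set lev"
            by (metis Diff_empty Diff_insert0 UnCI image_eqI insert_Diff)
        qed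
        then show ?thesis using 2 by (auto simp: J_def weights_def)
      qed
      moreover have "pre @ lev @ ext (length lev) = levels_below n E (Suc (Suc i))"
        by (simp add: levels_below_Suc pre_def lev_def ext_def)
      moreover have "levels_below n E (Suc i) = pre @ lev" by (simp add: levels_below_Suc pre_def lev_def)
      ultimately show ?case using 2 lenL
        by (intro runs_Store) (auto simp: J_def unchanged_def queue_def weights_def)
    qed simp
  qed
qed

definition listed :: "nat set list \<Rightarrow> memory \<Rightarrow> bool" where
  "listed xs m \<longleftrightarrow> m 0 5 = m 0 4 + length xs \<and> (\<forall>j<length xs. m 3 (m 0 4 + j) = set_encode (xs ! j))"

lemma runs_enumerate:
  assumes m: "graph_memory n E m" "m 0 16 = 2 ^ n" "m 0 15 = Z" "m 3 0 = 0"
    and L: "n + 2 \<le> L" "Z ^ n < 2 ^ L" "Z > 0" and b: "\<And>i. i \<le> n \<Longrightarrow> card (prefix_family n E i) \<le> b"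
  shows "runs L enumerate m (n * (b * (4 * (n * (n + 1)) + 1) + 1)) (\<lambda>m'.
    unchanged {2,4,5,6,7,8,9,10,12,14,17} {3,4} m m' \<and> listed (level n E n) m' \<and>
    weights Z (prefix_family n E n) m')"
proof -
  note B = power_bounds[OF L(1)]
  have one: "1 < (2::nat) ^ L" using B(1) by linarith
  let ?R = "{2,4,5,6,7,8,9,10,12,14,17}"
  define J where "J i m' \<longleftrightarrow> unchanged ?R {3,4} m m' \<and>
    queue m' = map set_encode (levels_below n E (Suc i)) \<and> m' 0 4 = length (levels_below n E i) \<and>
    weights Z (prefix_family n E i) m'" for i m'
  show ?thesis
    unfolding enumerate_def
  proof (intro runs_Store_Seq, goal_cases)
    case 4
    show ?case
    proof (rule runs_for_loop[where I = J and N = n and s = "b * (4 * (n * (n + 1)) + 1)"], goal_cases)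
      case 1
      show ?case using m by (auto simp: J_def unchanged_def queue_def levels_below_def weights_def prefix_family_0)
    next
      case (2 i m')
      then have u: "unchanged ?R {3,4} m m'" by (simp add: J_def)
      have "runs L extend_level m' (b * (4 * (n * (n + 1)) + 1)) (\<lambda>m''. 
        unchanged {4,5,6,7,8,9,10,12,14,17} {3,4} m' m'' \<and>
        queue m'' = map set_encode (levels_below n E (Suc (Suc i))) \<and>
        m'' 0 4 = length (levels_below n E (Suc i)) \<and> weights Z (prefix_family n E (Suc i)) m'')"
        using 2 m L b unchangedD(1)[OF u]
        by (intro runs_extend_level graph_memory_unchanged[OF m(1) u]) (auto simp: J_def)
      then show ?case
      proof (rule runs_mono, goal_cases)
        case (1 m'')
        then have "unchanged {4,5,6,7,8,9,10,12,14,17} {3,4} m' m''" by simp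
        from this u have "unchanged ?R {3,4} m m''" "m'' 0 2 = i"
          using 2 by (auto simp: unchanged_def)
        then show ?case using 1 by (auto simp: J_def unchanged_def queue_def weights_def)
      qed simp
    next
      case (3 i m')
      then show ?case using m by (auto simp: J_def unchanged_def graph_memory_def)
    next
      case (5 m')
      then have q: "queue m' = map set_encode (levels_below n E n @ level n E n)"
        by (simp add: J_def levels_below_Suc)
      show ?case using 5 queue_eqD[OF q] by (auto simp: J_def listed_def nth_append)
    qed (use B in auto)
  qed (use one in auto)
qed

section \<open>Passes over the table\<close>

definition each :: "prog \<Rightarrow> prog" where
  "each p = for_loop 17 (Sub (var 5) (var 4)) (Seq (assign 7 (Load 3 (Add (var 4) (var 17)))) p)"

text \<open>The loop itself writes cells 7 and 17, so \<open>J\<close> has to survive changes to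
  them; the conditions on \<open>R\<close> protect the queue bounds and the counter from the
  body.\<close>

lemma runs_each:
  assumes xs: "set xs \<subseteq> Pow {..<n}" "listed xs m" and L: "n + 2 \<le> L" "length xs < 2 ^ L"
    and R: "4 \<notin> R" "5 \<notin> R" "17 \<notin> R"
    and J: "J 0 m" "\<And>j m1 m2. J j m1 \<Longrightarrow> unchanged {7,17} {} m1 m2 \<Longrightarrow> J j m2"
    and body: "\<And>j m'. j < length xs \<Longrightarrow> unchanged (R \<union> {7,17}) {5} m m' \<Longrightarrow> J j m' \<Longrightarrow>
      m' 0 7 = set_encode (xs ! j) \<Longrightarrow> runs L p m' s (\<lambda>m''. unchanged R {5} m' m'' \<and> J (Suc j) m'')"
  shows "runs L (each p) m (length xs * (s + 1))
    (\<lambda>m'. unchanged (R \<union> {7,17}) {5} m m' \<and> J (length xs) m')"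
proof -
  note B = power_bounds[OF L(1)]
  let ?I = "\<lambda>j m'. unchanged (R \<union> {7,17}) {5} m m' \<and> J j m'"
  show ?thesis
    unfolding each_def
  proof (rule runs_for_loop[where I = ?I and N = "length xs" and s = s], goal_cases)
    case 1
    show ?case using J(2)[OF J(1), of "m(0 := (m 0)(17 := 0))"] by (simp add: unchanged_def)
  next
    case (2 j m')
    then have u: "unchanged (R \<union> {7,17}) {5} m m'" by simp
    have x: "m' 3 (m' 0 4 + j) = set_encode (xs ! j)"
      using unchangedD[OF u] R xs(2) 2(1) by (simp add: listed_def)
    have xb: "set_encode (xs ! j) < 2 ^ L"
    proof (rule less_trans[OF set_encode_less[of _ n]])
      show "xs ! j \<subseteq> {..<n}" using xs(1) nth_mem[OF 2(1)] by blast
    qed (use B(2)[of n] in simp)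
    show ?case
    proof (rule runs_Store_Seq, goal_cases)
      case 1
      show ?case using x xb 2 by simp
    next
      case 2
      let ?m = "m'(0 := (m' 0)(7 := set_encode (xs ! j)))"
      have um: "unchanged (R \<union> {7,17}) {5} m ?m" "unchanged {7,17} {} m' ?m"
        using u by (auto simp: unchanged_def)
      have "runs L p ?m s (\<lambda>m''. unchanged R {5} ?m m'' \<and> J (Suc j) m'')"
        using \<open>j < length xs\<close> um J(2)[of j m' ?m] \<open>?I j m'\<close> by (intro body) auto
      then have "runs L p ?m s (\<lambda>m''. m'' 0 17 = j \<and> ?I (Suc j) (m''(0 := (m'' 0)(17 := Suc j))))"
      proof (rule runs_mono, goal_cases)
        case (1 m'')
        then have u': "unchanged R {5} ?m m''" by simp
        have "m'' 0 17 = j" using unchangedD(1)[OF u', of 17] R \<open>m' 0 17 = j\<close> by simp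
        moreover have "unchanged (R \<union> {7,17}) {5} m (m''(0 := (m'' 0)(17 := Suc j)))"
          using u' um(1) by (simp add: unchanged_def)
        moreover have "J (Suc j) (m''(0 := (m'' 0)(17 := Suc j)))"
          by (rule J(2)[of _ m'']) (use 1 in \<open>auto simp: unchanged_def\<close>)
        ultimately show ?case by simp
      qed simp
      then show ?case using x \<open>m' 0 17 = j\<close> by simp
    qed
  next
    case (3 j m')
    then show ?case using xs(2) R by (auto simp: unchanged_def listed_def)
  qed (use L in auto)
qed

text \<open>The default 0 is the correct transform value at missing subsets of members, by convexity
  of the family.\<close>

definition table :: "nat set set \<Rightarrow> (nat set \<Rightarrow> nat) \<Rightarrow> nat \<Rightarrow> nat" where
  "table F g = (\<lambda>a. if set_decode a \<in> F then g (set_decode a) else 0)"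

lemma table_set_encode: "finite X \<Longrightarrow> table F g (set_encode X) = (if X \<in> F then g X else 0)"
  by (simp add: table_def)

lemma table_upd:
  assumes "X \<in> F" "finite X"
  shows "(table F g)(set_encode X := v) = table F (g(X := v))"
proof
  fix a
  have "a = set_encode X \<longleftrightarrow> set_decode a = X" using assms(2) by auto
  then show "((table F g)(set_encode X := v)) a = table F (g(X := v)) a"
    using assms by (simp add: table_def)
qed

lemma table_zero: "table F (\<lambda>_. 0) = (\<lambda>_. 0)"
  by (auto simp: table_def)

text \<open>During an update in place the table is a mixture \<open>h\<close> of old and new values.
  The entry being processed is still old because \<open>xs\<close> is distinct; about any other
  entry the body may only assume that it is one of the two.\<close>

lemma runs_each_table:
  assumes xs: "F \<subseteq> Pow {..<n}" "set xs = F" "distinct xs" "listed xs m"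
    and L: "n + 2 \<le> L" "length xs < 2 ^ L"
    and R: "4 \<notin> R" "5 \<notin> R" "17 \<notin> R"
    and m: "m 5 = table F g"
    and body: "\<And>X h m'. X \<in> F \<Longrightarrow> unchanged (R \<union> {7,17}) {5} m m' \<Longrightarrow> m' 0 7 = set_encode X \<Longrightarrow>
      m' 5 = table F h \<Longrightarrow> h X = g X \<Longrightarrow> (\<And>Y. h Y = g Y \<or> h Y = g' Y) \<Longrightarrow>
      runs L p m' s (\<lambda>m''. unchanged R {5} m' m'' \<and> m'' 5 = (m' 5)(set_encode X := g' X))"
  shows "runs L (each p) m (length xs * (s + 1))
    (\<lambda>m'. unchanged (R \<union> {7,17}) {5} m m' \<and> m' 5 = table F g')"
proof -
  define h where "h j Y = (if Y \<in> set (take j xs) then g' Y else g Y)" for j Y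
  have "runs L (each p) m (length xs * (s + 1))
    (\<lambda>m'. unchanged (R \<union> {7,17}) {5} m m' \<and> m' 5 = table F (h (length xs)))"
  proof (rule runs_each[where n = n and J = "\<lambda>j m'. m' 5 = table F (h j)"], goal_cases)
    case 8
    have "h 0 = g" by (simp add: h_def fun_eq_iff)
    then show ?case by (simp add: m)
  next
    case (9 j m1 m2)
    then show ?case by (simp add: unchanged_def)
  next
    case (10 j m')
    let ?X = "xs ! j"
    have X: "?X \<in> F" using 10 xs by auto
    then have "finite ?X" using xs(1) finite_subset[of ?X "{..<n}"] by auto
    have "?X \<notin> set (take j xs)"
      using xs(3) 10(1) by (auto simp: in_set_conv_nth nth_eq_iff_index_eq)
    then have hX: "h j ?X = g ?X" by (simp add: h_def)
    have "h (Suc j) = (h j)(?X := g' ?X)"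
      using 10(1) by (auto simp: h_def take_Suc_conv_app_nth fun_eq_iff)
    then have eq: "(table F (h j))(set_encode ?X := g' ?X) = table F (h (Suc j))"
      by (simp add: table_upd[OF X \<open>finite ?X\<close>])
    show ?case
      by (rule runs_mono[OF body[OF X 10(2) 10(4,3) hX]]) (use 10 eq in \<open>auto simp: h_def\<close>)
  qed (use assms in auto)
  moreover have "table F (h (length xs)) = table F g'"
    using xs(2) by (auto simp: table_def h_def)
  ultimately show ?thesis by simp
qed

definition init_table :: prog where
  "init_table = each (Store 5 (var 7) (Load 4 (var 7)))"

lemma runs_init_table:
  assumes xs: "F \<subseteq> Pow {..<n}" "set xs = F" "distinct xs" "listed xs m"
    and L: "n + 2 \<le> L" "length xs < 2 ^ L"
    and m: "m 5 = (\<lambda>_. 0)" "weights Z F m" and Z: "\<And>X. X \<in> F \<Longrightarrow> Z ^ card X < 2 ^ L"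
  shows "runs L init_table m (length xs)
    (\<lambda>m'. unchanged {7,17} {5} m m' \<and> m' 5 = table F (\<lambda>X. Z ^ card X))"
proof -
  have "runs L init_table m (length xs * (0 + 1))
    (\<lambda>m'. unchanged ({} \<union> {7,17}) {5} m m' \<and> m' 5 = table F (\<lambda>X. Z ^ card X))"
    unfolding init_table_def
  proof (rule runs_each_table[OF xs L, where g = "\<lambda>_. 0"], goal_cases)
    case (5 X h m')
    then have "m' 4 (set_encode X) = Z ^ card X" using m(2) by (simp add: weights_def unchanged_def)
    then show ?case using 5 Z[of X] by (intro runs_Store) (auto simp: unchanged_def)
  qed (use m table_zero in auto)
  then show ?thesis by simp
qed

definition transform :: "(expr \<Rightarrow> expr \<Rightarrow> expr) \<Rightarrow> prog" where
  "transform op = for_loop 2 (var 0) (each (If (bit_expr (var 7) (var 2))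
     (Store 5 (var 7) (op (Load 5 (var 7)) (Load 5 (Sub (var 7) (Load 6 (var 2)))))) Skip))"

lemma runs_transform:
  assumes xs: "F \<subseteq> Pow {..<n}" "set xs = F" "distinct xs" "listed xs m"
    and L: "n + 2 \<le> L" "length xs < 2 ^ L"
    and m: "graph_memory n E m" "m 5 = table F (G 0)"
    and op: "\<And>a b m. eval_expr (op a b) m = f (eval_expr a m) (eval_expr b m)"
    and G: "\<And>i X. i < n \<Longrightarrow> X \<in> F \<Longrightarrow> i \<in> X \<Longrightarrow>
        G (Suc i) X = f (G i X) (if X - {i} \<in> F then G i (X - {i}) else 0)"
      "\<And>i X. i < n \<Longrightarrow> i \<notin> X \<Longrightarrow> G (Suc i) X = G i X"
      "\<And>i X. i \<le> n \<Longrightarrow> X \<in> F \<Longrightarrow> G i X < 2 ^ L"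
  shows "runs L (transform op) m (n * (length xs + 1))
    (\<lambda>m'. unchanged {2,7,17} {5} m m' \<and> m' 5 = table F (G n))"
proof -
  note B = power_bounds[OF L(1)]
  let ?I = "\<lambda>i m'. unchanged {2,7,17} {5} m m' \<and> m' 5 = table F (G i)"
  show ?thesis
    unfolding transform_def
  proof (rule runs_for_loop[where I = ?I and N = n and s = "length xs"], goal_cases)
    case 1
    show ?case using m by (simp add: unchanged_def)
  next
    case (2 i m')
    then have u: "unchanged {2,7,17} {5} m m'" by simp
    have listed: "listed xs m'" using xs(4) unchangedD[OF u] by (simp add: listed_def)
    have "runs L (each (If (bit_expr (var 7) (var 2))
       (Store 5 (var 7) (op (Load 5 (var 7)) (Load 5 (Sub (var 7) (Load 6 (var 2)))))) Skip)) m'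
       (length xs * (0 + 1)) (\<lambda>m''. unchanged ({} \<union> {7,17}) {5} m' m'' \<and> m'' 5 = table F (G (Suc i)))"
    proof (rule runs_each_table[OF xs(1-3) listed L, where g = "G i"], goal_cases)
      case 4
      show ?case using 2 by simp
    next
      case (5 X h m'')
      have finX: "finite X" using 5(1) xs(1) finite_subset[of X "{..<n}"] by auto
      have u': "unchanged {2,7,17} {5} m m''" using u 5(2) by (auto simp: unchanged_def)
      have r: "m'' 0 2 = i" "m'' 6 i = 2 ^ i" "m'' 0 7 = set_encode X"
        using 5(2,3) 2(3) unchangedD(2)[OF u', of 6] m(1) 2(1) by (auto simp: unchanged_def graph_memory_def)
      have bit: "eval_expr (bit_expr (var 7) (var 2)) m'' = of_bool (i \<in> X)"
        using r finX by (simp add: set_encode_div_mod)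
      show ?case
      proof (rule runs_If, goal_cases)
        case 1
        then have "i \<in> X" using bit by (cases "i \<in> X") simp_all
        then have X: "X = insert i (X - {i})" by auto
        have "set_encode X = 2 ^ i + set_encode (X - {i})"
          by (subst X, subst set_encode_insert) (use finX in auto)
        then have e: "set_encode X - 2 ^ i = set_encode (X - {i})" by simp
        \<comment> \<open>Updating in place is sound: round \<open>i\<close> does not alter values
          at sets without \<open>i\<close>, so it is irrelevant whether \<open>X - {i}\<close> was
          visited before \<open>X\<close>.\<close>
        have "h (X - {i}) = G i (X - {i})"
          using 5(6)[of "X - {i}"] G(2)[of i "X - {i}"] 2(1) by auto
        then have v: "eval_expr (op (Load 5 (var 7)) (Load 5 (Sub (var 7) (Load 6 (var 2))))) m'' = G (Suc i) X"
          using r e 5(1,4,5) finX G(1)[OF 2(1) 5(1) \<open>i \<in> X\<close>] by (simp add: op table_set_encode)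
        show ?case
          by (rule runs_Store) (use v G(3)[of "Suc i" X] 2(1) 5(1) r in \<open>auto simp: unchanged_def\<close>)
      next
        case 2
        then have "i \<notin> X" using bit by (cases "i \<in> X") simp_all
        then have "m'' 5 (set_encode X) = G (Suc i) X"
          using 5(1,4,5) finX G(2)[OF \<open>i < n\<close>, of X] by (simp add: table_set_encode)
        then show ?case by (intro runs_Skip) (metis fun_upd_triv unchanged_refl)
      qed
    qed auto
    then show ?case
      by (rule runs_mono) (use 2 u in \<open>auto simp: unchanged_def\<close>)
  next
    case (3 i m')
    then show ?case using m(1) by (auto simp: unchanged_def graph_memory_def)
  qed (use B in auto)
qed

definition power_table :: prog where
  "power_table = each (Seq (assign 8 (Num 1)) (Seq
     (for_loop 12 (Sub (var 1) (Num 1)) (assign 8 (Mul (var 8) (Load 5 (var 7)))))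
     (Store 5 (var 7) (var 8))))"

lemma runs_power_table:
  assumes xs: "F \<subseteq> Pow {..<n}" "set xs = F" "distinct xs" "listed xs m"
    and L: "n + 2 \<le> L" "length xs < 2 ^ L"
    and m: "m 0 1 = k" "m 5 = table F g" "k \<le> n"
    and g: "\<And>X j. X \<in> F \<Longrightarrow> j \<le> k - 1 \<Longrightarrow> g X ^ j < 2 ^ L"
  shows "runs L power_table m (length xs * (n + 1))
    (\<lambda>m'. unchanged {7,8,12,17} {5} m m' \<and> m' 5 = table F (\<lambda>X. g X ^ (k - 1)))"
proof -
  note B = power_bounds[OF L(1)]
  have "runs L power_table m (length xs * (n + 1))
    (\<lambda>m'. unchanged ({8,12} \<union> {7,17}) {5} m m' \<and> m' 5 = table F (\<lambda>X. g X ^ (k - 1)))"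
    unfolding power_table_def
  proof (rule runs_each_table[OF xs L, where g = g], goal_cases)
    case (5 X h m')
    have finX: "finite X" using 5(1) xs(1) finite_subset[of X "{..<n}"] by auto
    define I where "I j m'' \<longleftrightarrow> unchanged {8,12} {} m' m'' \<and> m'' 0 8 = g X ^ j" for j m''
    have k1: "m' 0 1 = k" using 5(2) m by (simp add: unchanged_def)
    have gX: "m' 5 (set_encode X) = g X" using 5 finX by (simp add: table_set_encode)
    show ?case
    proof (rule runs_Store_Seq, goal_cases)
      case 1
      show ?case using B(1) by simp
    next
      case 2
      show ?case
      proof (rule runs_Seq[where R = "I (k - 1)" and s\<^sub>1 = n and s\<^sub>2 = 0], goal_cases)
        case 1
        show ?case
        proof (rule runs_for_loop[where I = I and N = "k - 1" and s = 0], goal_cases)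
          case 1
          show ?case by (simp add: I_def unchanged_def)
        next
          case (2 j m'')
          then have "m'' 0 8 = g X ^ j" "m'' 0 7 = set_encode X" "m'' 5 (set_encode X) = g X"
            using 5(3) gX by (auto simp: I_def unchanged_def)
          then show ?case using 2 g[OF 5(1), of "Suc j"]
            by (intro runs_Store) (auto simp: I_def unchanged_def mult.commute)
        qed (use B m k1 in \<open>auto simp: I_def unchanged_def\<close>)
      next
        case (2 m'')
        then have "m'' 0 8 = g X ^ (k - 1)" "m'' 0 7 = set_encode X" "m'' 5 = m' 5"
          using 5(3) by (auto simp: I_def unchanged_def)
        then show ?case using 2 g[OF 5(1), of "k - 1"]
          by (intro runs_Store) (auto simp: I_def unchanged_def)
      qed simp
    qed
  qed (use m in auto)
  then show ?thesis by (simp add: insert_commute)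
qed

text \<open>Subtracting the multiple given by the quotient leaves the remainder modulo
  \<open>Z ^ (card X + 1)\<close>; the divisor is the stored weight times \<open>Z\<close>.\<close>

definition check_table :: prog where
  "check_table = Seq (assign 9 (Num 0)) (Seq
     (each (If (Sub (Load 5 (var 7)) (Mul (Mul (Load 4 (var 7)) (var 15))
         (Div (Load 5 (var 7)) (Mul (Load 4 (var 7)) (var 15)))))
       (assign 9 (Num 1)) Skip))
     (assign 0 (var 9)))"

lemma runs_check_table:
  assumes xs: "F \<subseteq> Pow {..<n}" "set xs = F" "listed xs m"
    and L: "n + 2 \<le> L" "length xs < 2 ^ L"
    and m: "m 0 15 = Z" "m 5 = table F g" "weights Z F m"
  shows "runs L check_table m (length xs)
    (\<lambda>m'. m' 0 0 = of_bool (\<exists>X\<in>F. g X mod (Z ^ card X * Z) \<noteq> 0))"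
proof -
  have one: "1 < (2::nat) ^ L" using power_bounds(1)[OF L(1)] by linarith
  define J where "J j m' \<longleftrightarrow> m' 5 = table F g \<and>
    m' 0 9 = of_bool (\<exists>X\<in>set (take j xs). g X mod (Z ^ card X * Z) \<noteq> 0)" for j and m' :: memory
  show ?thesis
    unfolding check_table_def
  proof (rule runs_Store_Seq, goal_cases)
    case 2
    let ?m = "m(0 := (m 0)(9 := 0))"
    let ?p = "each (If (Sub (Load 5 (var 7)) (Mul (Mul (Load 4 (var 7)) (var 15))
         (Div (Load 5 (var 7)) (Mul (Load 4 (var 7)) (var 15))))) (assign 9 (Num 1)) Skip)"
    have "runs L ?p ?m (length xs * (0 + 1)) (\<lambda>m'. unchanged ({9} \<union> {7,17}) {5} ?m m' \<and> J (length xs) m')"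
    proof (rule runs_each[where n = n], goal_cases)
      case 8
      show ?case using m by (simp add: J_def)
    next
      case (9 j m1 m2)
      then show ?case by (simp add: J_def unchanged_def)
    next
      case (10 j m')
      let ?X = "xs ! j"
      have X: "?X \<in> F" using 10 xs by auto
      then have "finite ?X" using xs(1) finite_subset[of ?X "{..<n}"] by auto
      then have r: "m' 5 (set_encode ?X) = g ?X" "m' 4 (set_encode ?X) = Z ^ card ?X" "m' 0 15 = Z"
        "m' 0 7 = set_encode ?X"
        using 10 X m by (auto simp: J_def table_set_encode unchanged_def weights_def)
      have set: "set (take (Suc j) xs) = insert ?X (set (take j xs))"
        using 10(1) by (simp add: take_Suc_conv_app_nth)
      show ?case
      proof (rule runs_If, goal_cases)
        case 1
        then have "g ?X mod (Z ^ card ?X * Z) \<noteq> 0" using r by (simp add: minus_mult_div_eq_mod)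
        then show ?case using 10(3) one set
          by (intro runs_Store) (auto simp: J_def unchanged_def)
      next
        case 2
        then have "g ?X mod (Z ^ card ?X * Z) = 0" using r by (simp add: minus_mult_div_eq_mod)
        then show ?case using 10(3) set by (intro runs_Skip) (auto simp: J_def)
      qed
    qed (use xs L in \<open>auto simp: listed_def\<close>)
    then have "runs L ?p ?m (length xs) (J (length xs))" by (rule runs_mono) auto
    then show ?case
      by (intro runs_Seq[where R = "J (length xs)" and s\<^sub>1 = "length xs" and s\<^sub>2 = 0])
        (use xs(2) one in \<open>auto intro!: runs_Store simp: J_def\<close>)
  qed (use one in simp)
qed

section \<open>The algorithm\<close>

lemma table_cong: "(\<And>X. X \<in> F \<Longrightarrow> g X = g' X) \<Longrightarrow> table F g = table F g'"
  by (auto simp: table_def)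

definition solve :: prog where
  "solve = Seq (assign 16 (Load 6 (var 0))) (Seq (assign 15 (Num 1))
    (Seq (for_loop 2 (var 0) (assign 15 (Mul (var 15) (var 16))))
    (Seq enumerate (Seq init_table (Seq (transform Add) (Seq power_table
    (Seq (transform Sub) check_table)))))))"

text \<open>The choice of \<open>L\<close> reflects the largest numbers: zeta values are at most
  \<open>2 ^ n * Z ^ n = 2 ^ (n + n * n * n)\<close>, and they are raised to the power
  \<open>k - 1\<close>, which is below \<open>n\<close>.\<close>

lemma runs_solve:
  assumes m: "graph_memory n E m" "m 0 1 = k" "m 3 0 = 0" "m 5 = (\<lambda>_. 0)"
    and k: "2 \<le> k" "k \<le> n" and L: "L = (n + n * n * n) * n + n + 3"
    and b: "\<And>i. i \<le> n \<Longrightarrow> card (prefix_family n E i) \<le> b"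
  shows "runs L solve m (n + n * (b * (4 * (n * (n + 1)) + 1) + 1) + b + n * (b + 1) + b * (n + 1) + n * (b + 1) + b)
    (\<lambda>m'. m' 0 0 = of_bool (has_dominating_packing {..<n} E k))"
proof -
  define F where "F = prefix_family n E n"
  define Z :: nat where "Z = 2 ^ (n * n)"
  define M :: nat where "M = 2 ^ (n + n * n * n)"
  define w where "w X = Z ^ card X" for X :: "nat set"
  define xs where "xs = level n E n"
  define r where "r = k - 1"
  define c where "c = cover_sum F r w"
  have n: "n > 0" and r: "r > 0" "r < n" using k by (auto simp: r_def)
  have L2: "n + 2 \<le> L" using L by simp
  note B = power_bounds[OF L2]
  have F: "F \<subseteq> Pow {..<n}" "finite F" "set_convex F"
    unfolding F_def using set_convex_prefix_family by (auto simp: prefix_family_def)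
  have xs: "set xs = F" "distinct xs" "length xs = card F" "length xs \<le> b" "length xs \<le> 2 ^ n"
    using level_prefix_family[of n n E] length_level[of n n E] b[of n] by (auto simp: F_def xs_def)
  have xsL: "length xs < 2 ^ L" using xs(5) B(2)[of n] by (rule le_less_trans) simp
  have Zpos: "Z > 0" by (simp add: Z_def)
  have nn: "(n + n * n * n) * 1 \<le> (n + n * n * n) * n" using n by (intro mult_le_mono2) simp
  have Mn: "M ^ n < 2 ^ L" unfolding M_def power_mult[symmetric] by (intro power_strict_increasing) (auto simp: L)
  have MnL: "x < 2 ^ L" if "x \<le> M ^ n" for x using that Mn by (rule le_less_trans)
  have Mpow: "M ^ j \<le> M ^ n" if "j \<le> n" for j using that by (intro power_increasing) (simp_all add: M_def)
  have M1: "M \<le> M ^ n" using Mpow[of 1] n by simp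
  have ZM: "Z ^ n \<le> M" unfolding Z_def M_def power_mult[symmetric] by (intro power_increasing) auto
  have ZnL: "Z ^ n < 2 ^ L" using ZM M1 by (intro MnL) (rule order_trans)
  have card_le: "card X \<le> n" if "X \<in> F" for X
    using F(1) that card_mono[of "{..<n}" X] by auto
  have w_le: "w X \<le> Z ^ n" if "X \<in> F" for X
    unfolding w_def using card_le[OF that] Zpos by (intro power_increasing) auto
  have zeta_le: "zeta_on F w I X \<le> M" for I X
  proof -
    have "zeta_on F w I X \<le> (\<Sum>D\<in>F. w D)"
      unfolding zeta_on_def using F(2) by (intro sum_mono2) auto
    also have "\<dots> \<le> card F * Z ^ n" using sum_bounded_above[of F w "Z ^ n"] w_le by simp
    also have "\<dots> \<le> 2 ^ n * Z ^ n" using xs by (intro mult_le_mono1) simp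
    also have "\<dots> = M" by (simp add: M_def Z_def power_add power_mult)
    finally show ?thesis .
  qed
  have pow: "zeta_on F w {..<n} X ^ r = zeta_on F c {..<n} X" if "X \<in> F" for X
    unfolding c_def using F that r by (intro zeta_on_power) auto
  \<comment> \<open>Intermediate Moebius values are partial sums of the full transform of
    \<open>c\<close>, which equals a power of the already bounded transform of
    \<open>w\<close>.\<close>
  have zeta_c_le: "zeta_on F c {i..<n} X \<le> M ^ n" if "X \<in> F" for i X
  proof -
    have "zeta_on F c {i..<n} X \<le> zeta_on F c {..<n} X" using F(2) by (intro zeta_on_mono) auto
    also have "\<dots> \<le> M ^ r" unfolding pow[OF that, symmetric] by (intro power_mono zeta_le) simp
    also have "\<dots> \<le> M ^ n" using r by (intro Mpow) simp
    finally show ?thesis .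
  qed
  have outside: "(if X - {i} \<in> F then zeta_on F v I (X - {i}) else 0) = zeta_on F v I (X - {i})"
    if "X \<in> F" for X i v I
    using zeta_on_outside[OF F(3) that, of "X - {i}" v I] by auto
  have answer: "(\<exists>S\<in>F. c S mod (Z ^ card S * Z) \<noteq> 0) \<longleftrightarrow> has_dominating_packing {..<n} E k"
  proof -
    have "card F ^ r \<le> (2 ^ n) ^ r" using xs by (intro power_mono) auto
    also have "\<dots> < Z" unfolding Z_def power_mult[symmetric] using r n by (intro power_strict_increasing) auto
    finally have "card F ^ r < Z" .
    moreover have "finite D" if "D \<in> F" for D using F(1) that finite_subset[of D "{..<n}"] by auto
    ultimately show ?thesis
      unfolding has_dominating_packing_iff[OF k(1) n] c_def w_def F_def[symmetric] r_def[symmetric]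
      using cover_sum_mod[OF F(2)] by auto
  qed
  have lev: "m 6 n = 2 ^ n" "m 0 0 = n" using m(1) by (auto simp: graph_memory_def)
  define s where "s = n * (b * (4 * (n * (n + 1)) + 1) + 1)"
  define P where "P g m' \<longleftrightarrow> graph_memory n E m' \<and> m' 0 1 = k \<and> m' 0 15 = Z \<and> listed xs m' \<and>
    weights Z F m' \<and> m' 5 = table F g" for g m'
  have keep: "P g m'" if "P g' m''" "unchanged R {5} m'' m'" "R \<subseteq> {2,7,8,12,17}" "m' 5 = table F g" for g g' R m' m''
  proof -
    have R: "0 \<notin> R" "1 \<notin> R" "15 \<notin> R" "4 \<notin> R" "5 \<notin> R" using that(3) by auto
    have "graph_memory n E m'" using that R by (auto simp: P_def intro: graph_memory_unchanged)
    then show ?thesis using that(1,4) unchangedD[OF that(2)] R by (simp add: P_def listed_def weights_def)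
  qed
  have check: "runs L check_table m' b (\<lambda>m'. m' 0 0 = of_bool (has_dominating_packing {..<n} E k))"
    if "P c m'" for m'
    by (rule runs_mono[OF runs_check_table[OF F(1) xs(1) _ L2 xsL, where Z = Z and g = c]])
      (use that answer xs in \<open>auto simp: P_def\<close>)
  have moebius: "runs L (transform Sub) m' (n * (b + 1)) (P c)"
    if "P (\<lambda>X. zeta_on F w {..<n} X ^ r) m'" for m'
  proof -
    \<comment> \<open>The powers just computed are the zeta transform of \<open>c\<close>. Round
      \<open>i\<close> takes \<open>i\<close> out of the index set \<open>{i..<n}\<close>, until the
      empty set leaves \<open>c\<close> itself.\<close>
    have m5: "m' 5 = table F (zeta_on F c {0..<n})"
      using that pow by (auto simp: P_def atLeast0LessThan intro: table_cong)
    have ins: "{i..<n} = insert i {Suc i..<n}" if "i < n" for i using that by auto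
    have "runs L (transform Sub) m' (n * (length xs + 1))
      (\<lambda>m''. unchanged {2,7,17} {5} m' m'' \<and> m'' 5 = table F (zeta_on F c {n..<n}))"
    proof (rule runs_transform[where n = n and G = "\<lambda>i. zeta_on F c {i..<n}" and f = "(-)"])
      fix i X assume i: "i < n" "X \<in> F" "i \<in> X"
      show "zeta_on F c {Suc i..<n} X = zeta_on F c {i..<n} X -
          (if X - {i} \<in> F then zeta_on F c {i..<n} (X - {i}) else 0)"
        unfolding outside[OF i(2)] ins[OF i(1)]
        using zeta_on_insert[OF F(2), of i "{Suc i..<n}" X c] i(3) by (simp add: zeta_on_insert_notin)
    next
      fix i and X :: "nat set" assume "i < n" "i \<notin> X"
      then show "zeta_on F c {Suc i..<n} X = zeta_on F c {i..<n} X"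
        by (simp add: ins zeta_on_insert_notin)
    qed (use that F xs xsL L2 m5 zeta_c_le MnL in \<open>auto simp: P_def\<close>)
    moreover have "table F (zeta_on F c {n..<n}) = table F c"
      by (rule table_cong) (simp add: zeta_on_empty)
    ultimately show ?thesis
      using keep[OF that] xs(4) by (elim runs_mono) auto
  qed
  have power: "runs L power_table m' (b * (n + 1)) (P (\<lambda>X. zeta_on F w {..<n} X ^ r))"
    if "P (zeta_on F w {..<n}) m'" for m'
  proof -
    have "zeta_on F w {..<n} X ^ j < 2 ^ L" if "j \<le> k - 1" for X j
    proof (rule MnL)
      have "zeta_on F w {..<n} X ^ j \<le> M ^ j" by (intro power_mono zeta_le) simp
      also have "\<dots> \<le> M ^ n" using that k by (intro Mpow) simp
      finally show "zeta_on F w {..<n} X ^ j \<le> M ^ n" .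
    qed
    then have "runs L power_table m' (length xs * (n + 1))
      (\<lambda>m''. unchanged {7,8,12,17} {5} m' m'' \<and> m'' 5 = table F (\<lambda>X. zeta_on F w {..<n} X ^ (k - 1)))"
      using that F xs xsL L2 k by (intro runs_power_table) (auto simp: P_def)
    moreover have "length xs * (n + 1) \<le> b * (n + 1)" using xs(4) by (rule mult_le_mono1)
    ultimately show ?thesis
      using keep[OF that] by (elim runs_mono) (auto simp: r_def)
  qed
  have zeta: "runs L (transform Add) m' (n * (b + 1)) (P (zeta_on F w {..<n}))" if "P w m'" for m'
  proof -
    have m5: "m' 5 = table F (zeta_on F w {..<0})"
      using that by (auto simp: P_def zeta_on_empty intro: table_cong)
    have "runs L (transform Add) m' (n * (length xs + 1))
      (\<lambda>m''. unchanged {2,7,17} {5} m' m'' \<and> m'' 5 = table F (zeta_on F w {..<n}))"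
    proof (rule runs_transform[where n = n and G = "\<lambda>i. zeta_on F w {..<i}" and f = "(+)"])
      fix i X assume i: "i < n" "X \<in> F" "i \<in> X"
      show "zeta_on F w {..<Suc i} X = zeta_on F w {..<i} X +
          (if X - {i} \<in> F then zeta_on F w {..<i} (X - {i}) else 0)"
        unfolding outside[OF i(2)] lessThan_Suc using i F(2) by (intro zeta_on_insert) auto
    next
      fix i and X :: "nat set" assume "i < n" "i \<notin> X"
      then show "zeta_on F w {..<Suc i} X = zeta_on F w {..<i} X"
        by (simp add: lessThan_Suc zeta_on_insert_notin)
    next
      fix i and X :: "nat set"
      show "zeta_on F w {..<i} X < 2 ^ L" using zeta_le M1 by (intro MnL) (rule order_trans)
    qed (use that F xs xsL L2 m5 in \<open>auto simp: P_def\<close>)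
    then show ?thesis
      using keep[OF that] xs(4) by (elim runs_mono) auto
  qed
  have init: "runs L init_table m' b (P w)" if "P (\<lambda>_. 0) m'" for m'
  proof -
    have "Z ^ card X < 2 ^ L" if "X \<in> F" for X
      using w_le[OF that] ZnL unfolding w_def by (rule le_less_trans)
    then have "runs L init_table m' (length xs)
      (\<lambda>m''. unchanged {7,17} {5} m' m'' \<and> m'' 5 = table F (\<lambda>X. Z ^ card X))"
      using that F xs xsL L2 by (intro runs_init_table) (auto simp: P_def table_zero)
    then show ?thesis
      using keep[OF that] xs(4) by (elim runs_mono) (auto simp: w_def[abs_def])
  qed
  have enum: "runs L enumerate m' s (P (\<lambda>_. 0))"
    if "unchanged {2,15,16} {} m m'" "m' 0 15 = Z" "m' 0 16 = 2 ^ n" for m'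
  proof -
    have g: "graph_memory n E m'" using m(1) that(1) by (rule graph_memory_unchanged) auto
    have "runs L enumerate m' s (\<lambda>m''.
      unchanged {2,4,5,6,7,8,9,10,12,14,17} {3,4} m' m'' \<and> listed (level n E n) m'' \<and>
      weights Z (prefix_family n E n) m'')"
      unfolding s_def using g that m L2 ZnL Zpos b unchangedD[OF that(1)] by (intro runs_enumerate) auto
    then show ?thesis
    proof (rule runs_mono, goal_cases)
      case (1 m'')
      then have u: "unchanged {2,4,5,6,7,8,9,10,12,14,17} {3,4} m' m''" by simp
      have "graph_memory n E m''" using g u by (rule graph_memory_unchanged) auto
      then show ?case
        using 1 that unchangedD[OF u] unchangedD[OF that(1)] m by (simp add: P_def table_zero xs_def F_def)
    qed simp
  qed
  define I where "I j m' \<longleftrightarrow> unchanged {2,15,16} {} m m' \<and> m' 0 15 = (2 ^ n) ^ j \<and> m' 0 16 = 2 ^ n" for j m'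
  have loop: "runs L (for_loop 2 (var 0) (assign 15 (Mul (var 15) (var 16)))) m' n (I n)" if "I 0 m'" for m'
  proof (rule runs_for_loop[where I = I and N = n and s = 0], goal_cases)
    case 1
    show ?case using that by (simp add: I_def unchanged_def)
  next
    case (2 j m')
    have "(2::nat) ^ n * (2 ^ n) ^ j = 2 ^ (n * Suc j)" by (simp add: power_mult power_add)
    also have "\<dots> \<le> 2 ^ (n * n)" using 2(1) by (intro power_increasing mult_le_mono2) auto
    also have "\<dots> = Z ^ 1" by (simp add: Z_def)
    also have "\<dots> \<le> Z ^ n" using n Zpos by (intro power_increasing) auto
    finally have "(2::nat) ^ n * (2 ^ n) ^ j < 2 ^ L" using ZnL by (rule le_less_trans)
    then show ?case using 2 by (intro runs_Store) (auto simp: I_def unchanged_def mult.commute)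
  qed (use lev B in \<open>auto simp: I_def unchanged_def\<close>)
  have "runs L solve m (n + (s + (b + (n * (b + 1) + (b * (n + 1) + (n * (b + 1) + b))))))
    (\<lambda>m'. m' 0 0 = of_bool (has_dominating_packing {..<n} E k))"
    unfolding solve_def
  proof (rule runs_Store_Seq, goal_cases)
    case 1
    show ?case using lev B(2)[of n] by simp
  next
    case 2
    show ?case
    proof (rule runs_Store_Seq, goal_cases)
      case 1
      show ?case using B(1) by simp
    next
      case 2
      show ?case
      proof (rule runs_Seq[OF loop])
        fix m' assume "I n m'"
        then have "unchanged {2,15,16} {} m m'" "m' 0 15 = Z" "m' 0 16 = 2 ^ n"
          by (auto simp: I_def Z_def power_mult)
        from enum[OF this] show "runs L (Seq enumerate (Seq init_table (Seq (transform Add)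
            (Seq power_table (Seq (transform Sub) check_table))))) m'
            (s + (b + (n * (b + 1) + (b * (n + 1) + (n * (b + 1) + b)))))
            (\<lambda>m'. m' 0 0 = of_bool (has_dominating_packing {..<n} E k))"
          by (rule runs_Seq) (rule runs_Seq[OF init] runs_Seq[OF zeta] runs_Seq[OF power]
            runs_Seq[OF moebius] check order_refl | assumption)+
      qed (use lev in \<open>auto simp: I_def unchanged_def\<close>)
    qed
  qed
  then show ?thesis by (rule runs_mono) (auto simp: s_def)
qed

section \<open>Reading \<open>k\<close> and the trivial cases\<close>

definition read_digit :: prog where
  "read_digit = Seq (assign 1 (Add (var 1) (Mul (Sub (Load 2 (var 2)) (Num 1)) (Load 6 (var 2)))))
    (Store 6 (Add (var 2) (Num 1)) (Mul (Num 2) (Load 6 (var 2))))"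

text \<open>The digits 0 to \<open>n\<close> are read while bank 6 is filled with powers of two. A
  further digit means \<open>k \<ge> 2 ^ (n + 1) > n\<close>, where the answer is no; otherwise the
  two subtractions test \<open>k \<ge> 2\<close> and \<open>k > n\<close>.\<close>

definition decide_packing :: prog where
  "decide_packing = Seq (Store 6 (Num 0) (Num 1)) (Seq (for_loop 2 (Add (var 0) (Num 1)) read_digit)
    (If (Load 2 (Add (var 0) (Num 1))) (assign 0 (Num 0))
      (If (Sub (var 1) (Num 1))
        (If (Sub (var 1) (var 0)) (assign 0 (Num 0)) solve)
        (assign 0 (Num 1)))))"

lemma has_dominating_packing_le_1:
  assumes "k \<le> 1"
  shows "has_dominating_packing V E k"
proof (cases "k = 0")
  case True
  then show ?thesis unfolding has_dominating_packing_def by (intro exI[of _ "{}"]) auto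
next
  case False
  then show ?thesis using assms unfolding has_dominating_packing_def
    by (intro exI[of _ "{V}"]) (auto simp: dominating_set_def)
qed

text \<open>Past the last digit the cell is 0 and truncated subtraction gives 0, the correct leading
  digit; so the reading loop needs no end test.\<close>

lemma input_memory_digit: "input_memory n E k 2 i - 1 = k div 2 ^ i mod 2"
proof (cases "i < floorlog 2 k")
  case False
  then have "k < 2 ^ i" using floorlog_leD[of 2 k i] by simp
  then show ?thesis using False by (simp add: input_memory_def)
qed (simp add: input_memory_def)

lemma runs_decide_packing:
  assumes L: "L = (n + n * n * n) * n + n + 3"
    and b: "\<And>i. i \<le> n \<Longrightarrow> card (prefix_family n E i) \<le> b"
  shows "runs L decide_packing (input_memory n E k)
    (n + 1 + (n + n * (b * (4 * (n * (n + 1)) + 1) + 1) + b + n * (b + 1) + b * (n + 1) + n * (b + 1) + b))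
    (\<lambda>m'. m' 0 0 = of_bool (has_dominating_packing {..<n} E k))"
    (is "runs L _ ?m (n + 1 + ?s) ?Q")
proof -
  have L2: "n + 2 \<le> L" using L by simp
  note B = power_bounds[OF L2]
  define J where "J i m' \<longleftrightarrow> unchanged {1,2} {6} ?m m' \<and> m' 0 1 = k mod 2 ^ i \<and> (\<forall>j\<le>i. m' 6 j = 2 ^ j)"
    for i and m' :: memory
  have m0: "?m 0 0 = n" "?m 0 1 = 0" by (simp_all add: input_memory_def)
  show ?thesis
    unfolding decide_packing_def
  proof (rule runs_Store_Seq, goal_cases)
    case 1
    show ?case using B(1) by simp
  next
    case 2
    show ?case
    proof (rule runs_Seq[where R = "J (n + 1)" and s\<^sub>1 = "n + 1" and s\<^sub>2 = ?s], goal_cases)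
      case 1
      show ?case
      proof (rule runs_for_loop[where I = J and N = "n + 1" and s = 0], goal_cases)
        case 1
        show ?case using m0 by (simp add: J_def unchanged_def)
      next
        case (2 i m')
        then have r: "m' 0 1 = k mod 2 ^ i" "m' 6 i = 2 ^ i" "m' 0 2 = i" "m' 2 i - Suc 0 = k div 2 ^ i mod 2"
          using input_memory_digit[of n E k i] by (auto simp: J_def unchanged_def)
        have mod: "k mod 2 ^ i + (k div 2 ^ i mod 2) * 2 ^ i = k mod 2 ^ Suc i"
          unfolding power_Suc2 mod_mult2_eq by (simp only: add.commute mult.commute)
        have b1: "(2::nat) ^ Suc i < 2 ^ L" using B(2)[of "Suc i"] 2(1) by simp
        have b2: "k mod 2 ^ Suc i < 2 ^ L" using b1 by (rule less_trans[rotated]) simp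
        show ?case unfolding read_digit_def
        proof (intro runs_Store_Seq runs_Store, goal_cases)
          case 1
          show ?case using r mod b2 by simp
        next
          case 2
          show ?case using r b1 by simp
        next
          case 3
          show ?case using r mod \<open>J i m'\<close> by (auto simp: J_def unchanged_def le_Suc_eq)
        qed
      next
        case (3 i m')
        then show ?case using m0 by (simp add: J_def unchanged_def)
      qed (use B in auto)
    next
      case (2 m')
      then have r: "m' 0 0 = n" "m' 0 1 = k mod 2 ^ (n + 1)" "m' 2 = ?m 2" "m' 3 0 = 0" "m' 5 = (\<lambda>_. 0)"
        using m0 by (auto simp: J_def unchanged_def input_memory_def)
      have g: "graph_memory n E m'"
      proof -
        have "m' 1 (i * n + j) = of_bool ({i, j} \<in> E)" if "i < n" "j < n" for i j
        proof -
          have "i * n + j < Suc i * n" using that by simp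
          also have "\<dots> \<le> n * n" using that by (intro mult_le_mono1) simp
          finally show ?thesis using 2 that by (simp add: J_def unchanged_def input_memory_def)
        qed
        then show ?thesis using 2 r by (simp add: graph_memory_def J_def)
      qed
      show ?case
      proof (rule runs_If, goal_cases)
        case 1
        then have "n + 1 < floorlog 2 k" using r by (auto simp: input_memory_def split: if_splits)
        then have "2 ^ (n + 1) \<le> k" using floorlog_geD[of "n + 2" 2 k] by simp
        moreover have "n + 1 < 2 ^ (n + 1)" by (rule less_exp)
        ultimately have "\<not> has_dominating_packing {..<n} E k"
          using dominating_packing_le[of n E k] by (cases "k \<ge> 2") auto
        then show ?case by (intro runs_Store) auto
      next
        case 2
        then have "\<not> n + 1 < floorlog 2 k" using r by (auto simp: input_memory_def)
        then have "k < 2 ^ (n + 1)" using floorlog_leD[of 2 k "n + 1"] by simp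
        then have k: "m' 0 1 = k" using r by simp
        show ?case
        proof (rule runs_If, goal_cases)
          case 1
          then have "2 \<le> k" using k by simp
          show ?case
          proof (rule runs_If, goal_cases)
            case 1
            then have "\<not> has_dominating_packing {..<n} E k"
              using dominating_packing_le[of n E k] \<open>2 \<le> k\<close> k r by auto
            then show ?case by (intro runs_Store) auto
          next
            case 2
            then show ?case using g k r L b \<open>2 \<le> k\<close> by (intro runs_solve) auto
          qed
        next
          case 2
          then have "has_dominating_packing {..<n} E k"
            using k by (intro has_dominating_packing_le_1) simp
          then show ?case using B(1) by (intro runs_Store) auto
        qed
      qed
    qed simp
  qed
qed

theorem theorem3p4:
  "\<exists>(A :: prog) (p :: nat poly). \<forall>(n :: nat) (\<Delta> :: nat) (E :: nat set set) (k :: nat).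
     simple_graph {..<n} E \<and> max_degree {..<n} E = \<Delta> \<longrightarrow>
       (\<exists>t m. exec A (input_memory n E k) t m
          \<and> m 0 0 = of_bool (has_dominating_packing {..<n} E k)
          \<and> real t \<le> real (poly p n) *
               max 1 ((2 ^ (\<Delta> + 1) - 2) powr (real n / real (\<Delta> + 1))))"
proof -
  define W where "W = prog_weight decide_packing"
  \<comment> \<open>The factors are the weight of the program text, the square of \<open>L\<close>
    as a polynomial in \<open>n\<close>, and the number of loop iterations per unit of
    \<open>b\<close>.\<close>
  define p :: "nat poly" where "p = [:W:] * [:3, 1, 1, 0, 1:]\<^sup>2 * [:5, 9, 4, 4:]"
  show ?thesis
  proof (rule exI[of _ decide_packing], rule exI[of _ p], intro allI impI, elim conjE)
    fix n \<Delta> :: nat and E :: "nat set set" and k :: nat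
    assume G: "simple_graph {..<n} E" "max_degree {..<n} E = \<Delta>"
    define L where "L = (n + n * n * n) * n + n + 3"
    define C where "C = (\<lambda>i. card (prefix_family n E i)) ` {..n}"
    define b where "b = Max C"
    let ?X = "max 1 ((2 ^ (\<Delta> + 1) - 2) powr (real n / real (\<Delta> + 1)))"
    have C: "finite C" "C \<noteq> {}" by (auto simp: C_def)
    have b_le: "card (prefix_family n E i) \<le> b" if "i \<le> n" for i
      unfolding b_def using that by (intro Max_ge[OF C(1)]) (auto simp: C_def)
    have "b \<in> C" unfolding b_def using C by (rule Max_in)
    then have bX: "real b \<le> ?X" unfolding C_def using card_prefix_family_le[OF G] by auto
    \<comment> \<open>Level 0 consists of the empty set. With \<open>b \<ge> 1\<close> the
      iterations not proportional to \<open>b\<close> can be multiplied by \<open>b\<close>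
      too.\<close>
    have b1: "1 \<le> b" using b_le[of 0] by (simp add: prefix_family_0)
    have "bounded_memory L (input_memory n E k)"
    proof -
      have "n + 2 < 2 ^ L" by (rule power_bounds) (simp add: L_def)
      moreover have "k div 2 ^ i mod 2 \<le> 1" for i by simp
      ultimately show ?thesis
        by (auto simp: bounded_memory_def input_memory_def L_def of_bool_def intro: le_less_trans)
    qed
    then obtain t m where t: "exec decide_packing (input_memory n E k) t m"
      "t \<le> W * L\<^sup>2 * (n + 1 + (n + n * (b * (4 * (n * (n + 1)) + 1) + 1) + b + n * (b + 1) + b * (n + 1) + n * (b + 1) + b) + 1)"
      "m 0 0 = of_bool (has_dominating_packing {..<n} E k)"
      using runs_decide_packing[OF L_def b_le, where k = k] unfolding runs_def W_def by blast
    have "n + 1 + (n + n * (b * (4 * (n * (n + 1)) + 1) + 1) + b + n * (b + 1) + b * (n + 1) + n * (b + 1) + b) + 1 =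
        b * (n * (4 * (n * (n + 1)) + 1) + 3 * n + 3) + 1 * (5 * n + 2)"
      by (simp add: algebra_simps)
    also have "\<dots> \<le> b * (n * (4 * (n * (n + 1)) + 1) + 3 * n + 3) + b * (5 * n + 2)"
      using b1 by (intro add_left_mono mult_le_mono1)
    also have "\<dots> = poly [:5, 9, 4, 4:] n * b" by (simp add: algebra_simps)
    finally have "t \<le> W * L\<^sup>2 * (poly [:5, 9, 4, 4:] n * b)"
      using t(2) by (meson mult_le_mono2 order_trans)
    also have "L = poly [:3, 1, 1, 0, 1:] n" by (simp add: L_def algebra_simps)
    finally have "t \<le> W * (poly [:3, 1, 1, 0, 1:] n)\<^sup>2 * (poly [:5, 9, 4, 4:] n * b)" .
    moreover have "poly [:W:] n = W" by simp
    ultimately have "t \<le> poly p n * b" by (simp only: p_def poly_mult poly_power mult.assoc)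
    then have "real t \<le> real (poly p n) * real b" by (metis of_nat_le_iff of_nat_mult)
    also have "\<dots> \<le> real (poly p n) * ?X" using bX by (intro mult_left_mono) auto
    finally show "\<exists>t m. exec decide_packing (input_memory n E k) t m \<and>
        m 0 0 = of_bool (has_dominating_packing {..<n} E k) \<and> real t \<le> real (poly p n) * ?X"
      using t by blast
  qed
qed

end
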